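(* Let $\alpha\in(0,1)$ and let \[ E=\{x\in(-1,1)^2: x_2<\operatorname{sgn}(x_1)|x_1|^{1+\alpha}\}. \] Then $\partial E$ is of class $\mathrm{C}^{1,\alpha}$ in $(-1,1)^2$ but not of class $\mathrm{C}^{1,\beta}$ near $0$ for any $\beta>\alpha$, and there exists a (local) variational mean curvature $H$ of $E$ in $(-1,1)^2$ such that $H\in\mathrm{L}^p((-1,1)^2)$ for every $p\in[1,\infty)$ with $\alpha>\frac{p-2}{p+1}$.
   Context: A set $E$ of finite perimeter in an open set $U$ has (local) variational mean curvature $H\in\mathrm{L}^1(U)$ in $U$ if $\mathrm{P}(E,U)-\int_{E\cap U}H\le \mathrm{P}(F,U)-\int_{F\cap U}H$ for all measurable $F$ with $F\triangle E\Subset U$, where $\mathrm{P}(\cdot,U)$ is the perimeter in $U$. *)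

theory Defs
  imports "HOL-Analysis.Analysis"
begin

definition test_field :: "(real^2) set \<Rightarrow> (real^2 \<Rightarrow> real^2) \<Rightarrow> bool" where
  "test_field U \<phi> \<longleftrightarrow>
     (\<exists>D. (\<forall>x. (\<phi> has_derivative D x) (at x)) \<and> (\<forall>v. continuous_on UNIV (\<lambda>x. D x v))) \<and>
     (\<exists>K. compact K \<and> K \<subseteq> U \<and> (\<forall>x. x \<notin> K \<longrightarrow> \<phi> x = 0)) \<and>
     (\<forall>x. norm (\<phi> x) \<le> 1)"

definition divergence :: "(real^2 \<Rightarrow> real^2) \<Rightarrow> real^2 \<Rightarrow> real" where
  "divergence \<phi> x = (\<Sum>i\<in>UNIV. frechet_derivative \<phi> (at x) (axis i 1) $ i)"

definition perimeter :: "(real^2) set \<Rightarrow> (real^2) set \<Rightarrow> ereal" where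
  "perimeter E U = (SUP \<phi>\<in>{\<phi>. test_field U \<phi>}. ereal (LINT x:E|lebesgue. divergence \<phi> x))"

definition finite_perimeter_in :: "(real^2) set \<Rightarrow> (real^2) set \<Rightarrow> bool" where
  "finite_perimeter_in E U \<longleftrightarrow> E \<in> sets lebesgue \<and> perimeter E U < \<infinity>"

definition var_mean_curvature :: "(real^2) set \<Rightarrow> (real^2) set \<Rightarrow> (real^2 \<Rightarrow> real) \<Rightarrow> bool" where
  "var_mean_curvature E U H \<longleftrightarrow>
     open U \<and> finite_perimeter_in E U \<and> set_integrable lebesgue U H \<and>
     (\<forall>F. F \<in> sets lebesgue \<longrightarrow>
          (\<exists>K. compact K \<and> K \<subseteq> U \<and> sym_diff F E \<subseteq> K) \<longrightarrow>
          perimeter E U - ereal (LINT x:(E \<inter> U)|lebesgue. H x)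
            \<le> perimeter F U - ereal (LINT x:(F \<inter> U)|lebesgue. H x))"

definition in_Lp :: "real \<Rightarrow> (real^2) set \<Rightarrow> (real^2 \<Rightarrow> real) \<Rightarrow> bool" where
  "in_Lp p U H \<longleftrightarrow> set_borel_measurable lebesgue U H \<and>
                    set_integrable lebesgue U (\<lambda>x. \<bar>H x\<bar> powr p)"

definition C1a_boundary :: "real \<Rightarrow> (real^2) set \<Rightarrow> (real^2) set \<Rightarrow> bool" where
  "C1a_boundary a E U \<longleftrightarrow>
     (\<forall>x \<in> frontier E \<inter> U. \<exists>r>0. \<exists>(R::real^2 \<Rightarrow> real^2) (f::real \<Rightarrow> real) f' (C::real).
        orthogonal_transformation R \<and>
        (\<forall>t. (f has_real_derivative f' t) (at t)) \<and>
        (\<forall>s\<in>{-r..r}. \<forall>t\<in>{-r..r}. \<bar>f' s - f' t\<bar> \<le> C * \<bar>s - t\<bar> powr a) \<and>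
        E \<inter> ball x r = {y \<in> ball x r. R (y - x) $ 2 < f (R (y - x) $ 1)})"

definition square :: "(real^2) set" where
  "square = {x. \<forall>i. \<bar>x $ i\<bar> < 1}"

definition Eset :: "real \<Rightarrow> (real^2) set" where
  "Eset a = {x \<in> square. x $ 2 < sgn (x $ 1) * \<bar>x $ 1\<bar> powr (1 + a)}"

end

theory Submission
  imports Defs
begin

text \<open>
  The curvature comes from a calibration. Write \<open>u(t) = sgn t |t|^(1+\<alpha>)\<close> and
  \<open>w = (|x1|^(2+2\<alpha>) + x2^2) / 2\<close>. The function \<open>q = (1+\<alpha>) w^(\<alpha>/(2+2\<alpha>))\<close> equals \<open>u'\<close> on
  the graph of \<open>u\<close>, so the field \<open>X = (-q, 1) / sqrt (1 + q^2)\<close> has length at most 1 and is the outer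
  normal of \<open>E\<close> there; hence \<open>H = div X\<close> is a variational mean curvature. Everything scales under
  \<open>(x1, x2) \<mapsto> (l x1, l^(1+\<alpha>) x2)\<close>, which gives \<open>|H| \<le> 4 w^(-(1-\<alpha>)/(2+2\<alpha>))\<close>, and weighting the two
  terms of \<open>w\<close> geometrically gives \<open>|H| \<le> 8 |x1|^(-s) |x2|^(-s)\<close> with \<open>s = (1-\<alpha>)/(2+\<alpha>)\<close>. This is
  in \<open>L^p\<close> iff \<open>s p < 1\<close>, i.e. \<open>(p-2)/(p+1) < \<alpha>\<close>. The competing test fields are obtained
  by cutting \<open>X\<close> off near the boundary of the square and adding \<open>\<epsilon>\<close> inside \<open>w\<close>, which makes it
  \<open>C^1\<close> without spoiling the bound on the divergence.

  \<open>C^(1,\<beta>)\<close> regularity fails because, in whatever rotated frame the graph is written, its slope at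
  \<open>(t, u(t))\<close> differs from that at \<open>0\<close> by a quantity comparable with \<open>u'(t) = (1+\<alpha>) |t|^\<alpha>\<close>.
\<close>

subsection \<open>Signed powers\<close>

text \<open>At the origin the difference quotient has modulus
  \<open>\<bar>h\<bar> powr (c - 1)\<close>, which tends to 0 because \<open>c > 1\<close>;
  elsewhere the sign is locally constant.\<close>

lemma DERIV_abs_powr:
  fixes c t :: real
  assumes "1 < c"
  shows "((\<lambda>t. \<bar>t\<bar> powr c) has_real_derivative c * sgn t * \<bar>t\<bar> powr (c - 1)) (at t)"
proof (cases "t = 0")
  case True
  have "((\<lambda>h. \<bar>\<bar>h\<bar> powr c / h\<bar>) \<longlongrightarrow> 0) (at 0)"
  proof -
    have "((\<lambda>h::real. \<bar>h\<bar> powr (c - 1)) \<longlongrightarrow> \<bar>0\<bar> powr (c - 1)) (at 0)"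
      using assms by (intro tendsto_powr' tendsto_intros) auto
    moreover have "\<bar>\<bar>h\<bar> powr c / h\<bar> = \<bar>h\<bar> powr (c - 1)" for h :: real
      by (cases "h = 0") (auto simp: powr_diff abs_divide)
    ultimately show ?thesis by simp
  qed
  then have "((\<lambda>h. \<bar>h\<bar> powr c / h) \<longlongrightarrow> 0) (at 0)"
    by (rule tendsto_rabs_zero_cancel)
  then show ?thesis using True assms by (simp add: DERIV_def)
next
  case False
  show ?thesis
  proof (cases "t > 0")
    case True
    have "((\<lambda>t. t powr c) has_real_derivative c * t powr (c - 1)) (at t)"
      by (rule has_real_derivative_powr) fact
    then have "((\<lambda>t. \<bar>t\<bar> powr c) has_real_derivative c * t powr (c - 1)) (at t)"
      by (rule has_field_derivative_transform_within[where d = t]) (use True in \<open>auto simp: dist_real_def\<close>)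
    then show ?thesis using True by simp
  next
    case neg: False
    have "((\<lambda>t. (- t) powr c) has_real_derivative - c * (- t) powr (c - 1)) (at t)"
      using False neg by (auto intro!: derivative_eq_intros)
    then have "((\<lambda>t. \<bar>t\<bar> powr c) has_real_derivative - c * (- t) powr (c - 1)) (at t)"
      by (rule has_field_derivative_transform_within[where d = "- t"])
         (use False neg in \<open>auto simp: dist_real_def\<close>)
    then show ?thesis using False neg by simp
  qed
qed

text \<open>The odd extension of the power function. Exponents multiply under composition, so the
  graph function \<open>spow (1 + a)\<close> has the inverse
  \<open>spow (1 / (1 + a))\<close>.\<close>

definition spow :: "real \<Rightarrow> real \<Rightarrow> real" where
  "spow c t = sgn t * \<bar>t\<bar> powr c"

lemma sgn_spow [simp]: "sgn (spow c t) = sgn t"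
  by (cases "t = 0") (auto simp: spow_def sgn_mult)

lemma abs_spow: "\<bar>spow c t\<bar> = \<bar>t\<bar> powr c"
  by (simp add: spow_def abs_mult abs_sgn_eq)

lemma spow_spow: "spow c (spow d t) = spow (d * c) t"
  by (simp add: spow_def[of c] abs_spow powr_powr spow_def[of "d * c"])

lemma spow_0 [simp]: "spow c 0 = 0"
  by (simp add: spow_def)

lemma spow_1 [simp]: "spow 1 t = t"
  by (simp add: spow_def sgn_mult_abs)

lemma spow_mono_iff:
  assumes "0 < c"
  shows "spow c s < spow c t \<longleftrightarrow> s < t"
proof -
  have mono: "spow c s < spow c t" if "s < t" for s t
  proof (cases "0 \<le> s \<or> t \<le> 0")
    case True
    then show ?thesis
      using that assms powr_less_mono2[of c "\<bar>s\<bar>" "\<bar>t\<bar>"] powr_less_mono2[of c "\<bar>t\<bar>" "\<bar>s\<bar>"]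
      by (auto simp: spow_def sgn_if)
  next
    case False
    have "spow c s < 0" "0 < spow c t"
      using False by (auto simp: spow_def)
    then show ?thesis by simp
  qed
  show ?thesis using mono[of s t] mono[of t s] by (cases s t rule: linorder_cases) auto
qed

lemma borel_measurable_spow [measurable]: "spow c \<in> borel_measurable borel"
  unfolding spow_def[abs_def] by measurable

lemma spow_bounds:
  assumes "0 < c"
  shows "spow c t < 1 \<longleftrightarrow> t < 1" "- 1 < spow c t \<longleftrightarrow> - 1 < t"
  using spow_mono_iff[OF assms, of t 1] spow_mono_iff[OF assms, of "- 1" t] by (auto simp: spow_def)

lemma abs_spow_le:
  assumes "1 \<le> c" "\<bar>t\<bar> \<le> 1"
  shows "\<bar>spow c t\<bar> \<le> \<bar>t\<bar>"
  using powr_mono'[of 1 c "\<bar>t\<bar>"] assms by (cases "t = 0") (auto simp: abs_spow)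

lemma DERIV_spow:
  fixes c t :: real
  assumes "1 < c"
  shows "(spow c has_real_derivative c * \<bar>t\<bar> powr (c - 1)) (at t)"
proof (cases "t = 0")
  case True
  have "((\<lambda>h. sgn h * \<bar>h\<bar> powr c / h) \<longlongrightarrow> 0) (at 0)"
  proof -
    have "((\<lambda>h::real. \<bar>h\<bar> powr (c - 1)) \<longlongrightarrow> \<bar>0\<bar> powr (c - 1)) (at 0)"
      using assms by (intro tendsto_powr' tendsto_intros) auto
    moreover have "sgn h * \<bar>h\<bar> powr c / h = \<bar>h\<bar> powr (c - 1)" for h :: real
      by (cases "h = 0") (auto simp: powr_diff sgn_if)
    ultimately show ?thesis by simp
  qed
  then show ?thesis using True by (simp add: DERIV_def spow_def)
next
  case False
  have "((\<lambda>t. sgn t * (\<bar>t\<bar> powr c)) has_real_derivative sgn t * (c * sgn t * \<bar>t\<bar> powr (c - 1))) (at t)"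
  proof (rule has_field_derivative_transform_within[where d = "\<bar>t\<bar>"])
    show "((\<lambda>s. sgn t * (\<bar>s\<bar> powr c)) has_real_derivative sgn t * (c * sgn t * \<bar>t\<bar> powr (c - 1))) (at t)"
      using assms by (intro DERIV_cmult DERIV_abs_powr)
    fix s assume "dist s t < \<bar>t\<bar>"
    then have "sgn s = sgn t" by (auto simp: dist_real_def sgn_if)
    then show "sgn t * (\<bar>s\<bar> powr c) = sgn s * (\<bar>s\<bar> powr c)" by simp
  qed (use False in auto)
  moreover have "sgn t * (c * sgn t * \<bar>t\<bar> powr (c - 1)) = c * \<bar>t\<bar> powr (c - 1)"
    using False by (simp add: sgn_if)
  ultimately show ?thesis by (simp add: spow_def[abs_def])
qed

lemma continuous_on_spow: "1 < c \<Longrightarrow> continuous_on S (spow c)"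
  by (rule DERIV_continuous_on) (rule DERIV_spow[THEN has_field_derivative_at_within])

lemma continuous_on_abs_powr:
  fixes c :: real
  assumes "0 < c"
  shows "continuous_on S (\<lambda>t. \<bar>t\<bar> powr c)"
  using assms by (intro continuous_on_powr' continuous_intros) auto

text \<open>A power with exponent below 1 is subadditive, and the triangle inequality then bounds
  its increments. This is the Hoelder estimate for the slope of the graph.\<close>

lemma abs_powr_diff_le:
  fixes a s t :: real
  assumes "0 < a" "a < 1"
  shows "\<bar>\<bar>s\<bar> powr a - \<bar>t\<bar> powr a\<bar> \<le> \<bar>s - t\<bar> powr a"
proof -
  have subadd: "(x + y) powr a \<le> x powr a + y powr a" if "0 \<le> x" "0 \<le> y" for x y :: real
  proof (cases "x + y = 0")
    case True
    then show ?thesis using that by simp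
  next
    case False
    define z where "z = x + y"
    have z: "z > 0" using False that by (simp add: z_def)
    \<comment> \<open>Applied to the fractions \<open>x / z\<close> and \<open>y / z\<close>, which
      sum to 1, this yields subadditivity after multiplication by \<open>z powr a\<close>.\<close>
    have *: "v \<le> v powr a" if "0 \<le> v" "v \<le> 1" for v :: real
      using that assms powr_mono'[of a 1 v] by (cases "v = 0") auto
    have "1 = x / z + y / z" using z using z_def by (metis add_divide_distrib divide_self less_irrefl)
    also have "\<dots> \<le> (x / z) powr a + (y / z) powr a"
      using that z by (intro add_mono *) (auto simp: z_def)
    also have "\<dots> = (x powr a + y powr a) / z powr a"
      using that z by (simp add: powr_divide add_divide_distrib)
    finally show ?thesis using z by (simp add: z_def[symmetric] field_simps)
  qed
  have "\<bar>s\<bar> powr a \<le> \<bar>t\<bar> powr a + \<bar>s - t\<bar> powr a" for s t :: real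
    using subadd[of "\<bar>t\<bar>" "\<bar>s - t\<bar>"] powr_mono2[of a "\<bar>s\<bar>" "\<bar>t\<bar> + \<bar>s - t\<bar>"] assms
    by linarith
  from this[of s t] this[of t s] show ?thesis by (simp add: abs_minus_commute abs_le_iff)
qed

subsection \<open>Regularity of the boundary\<close>

lemma open_square: "open square"
proof -
  have eq: "square = (\<Inter>i\<in>UNIV. {x. \<bar>x $ i\<bar> < 1})" by (auto simp: square_def)
  have "open {x::real^2. \<bar>x $ i\<bar> < 1}" for i
    by (intro open_Collect_less continuous_intros)
  then show ?thesis unfolding eq by (intro open_INT) auto
qed

lemma Eset_iff:
  "x \<in> Eset a \<longleftrightarrow> \<bar>x $ 1\<bar> < 1 \<and> \<bar>x $ 2\<bar> < 1 \<and> x $ 2 < spow (1 + a) (x $ 1)"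
  by (auto simp: Eset_def square_def forall_2 spow_def)

text \<open>The identity serves as the rotation and \<open>f\<close> is the graph function
  translated so that \<open>x\<close> becomes the origin. In a ball inside the square only the graph
  inequality of \<open>Eset\<close> remains.\<close>

lemma C1a_boundary_Eset:
  assumes "0 < a" "a < 1"
  shows "C1a_boundary a (Eset a) square"
  unfolding C1a_boundary_def
proof
  fix x assume "x \<in> frontier (Eset a) \<inter> square"
  then obtain r where r: "r > 0" "ball x r \<subseteq> square"
    using open_square by (auto simp: open_contains_ball)
  define f where "f = (\<lambda>t. spow (1 + a) (x $ 1 + t) - x $ 2)"
  define f' where "f' = (\<lambda>t. (1 + a) * \<bar>x $ 1 + t\<bar> powr a)"
  have "(f has_real_derivative f' t) (at t)" for t
  proof -
    have "(spow (1 + a) has_real_derivative f' t) (at (t + x $ 1))"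
      using DERIV_spow[of "1 + a" "t + x $ 1"] assms by (simp add: f'_def add.commute)
    then have "((\<lambda>t. spow (1 + a) (t + x $ 1)) has_real_derivative f' t) (at t)"
      by (simp only: DERIV_shift)
    then have "((\<lambda>t. spow (1 + a) (t + x $ 1) - x $ 2) has_real_derivative f' t - 0) (at t)"
      by (intro DERIV_diff DERIV_const)
    then show ?thesis by (simp add: f_def add.commute)
  qed
  moreover have "\<bar>f' s - f' t\<bar> \<le> (1 + a) * \<bar>s - t\<bar> powr a" for s t
    using abs_powr_diff_le[OF assms, of "x $ 1 + s" "x $ 1 + t"] assms
    by (simp add: f'_def abs_mult flip: right_diff_distrib)
  moreover have "Eset a \<inter> ball x r = {y \<in> ball x r. (y - x) $ 2 < f ((y - x) $ 1)}"
    using r by (auto simp: f_def Eset_def spow_def)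
  ultimately show "\<exists>r>0. \<exists>(R::real^2 \<Rightarrow> real^2) (f::real \<Rightarrow> real) f' (C::real).
        orthogonal_transformation R \<and>
        (\<forall>t. (f has_real_derivative f' t) (at t)) \<and>
        (\<forall>s\<in>{-r..r}. \<forall>t\<in>{-r..r}. \<bar>f' s - f' t\<bar> \<le> C * \<bar>s - t\<bar> powr a) \<and>
        Eset a \<inter> ball x r = {y \<in> ball x r. R (y - x) $ 2 < f (R (y - x) $ 1)}"
    using r(1) by (intro exI[of _ r] conjI exI[of _ "\<lambda>x. x"] exI[of _ f] exI[of _ f'] exI[of _ "1 + a"])
       (auto simp: orthogonal_transformation_def)
qed

section \<open>Failure of higher Hoelder regularity at the origin\<close>

lemma zero_in_frontier_Eset:
  assumes "0 < a"
  shows "0 \<in> frontier (Eset a)"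
proof -
  have "0 \<notin> Eset a" by (simp add: Eset_iff)
  moreover have "0 \<in> closure (Eset a)"
    unfolding closure_approachable
  proof (intro allI impI)
    fix e :: real assume e: "0 < e"
    define d where "d = min (e / 2) (1 / 2)"
    have "norm (vector [0, - d] :: real^2) \<le> (\<Sum>i\<in>UNIV. \<bar>(vector [0, - d] :: real^2) $ i\<bar>)"
      by (rule norm_le_l1_cart)
    also have "\<dots> < e" using e by (simp add: sum_2 d_def)
    finally have "dist (vector [0, - d] :: real^2) 0 < e" by simp
    moreover have "vector [0, - d] \<in> Eset a" using e by (simp add: Eset_iff d_def spow_def)
    ultimately show "\<exists>y\<in>Eset a. dist y 0 < e" by blast
  qed
  ultimately show ?thesis using interior_subset by (auto simp: frontier_def)
qed

text \<open>The four numbers are the matrix entries of \<open>R\<close>, and the three equations say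
  that its columns are orthonormal. The row of the \<open>\<tau>\<close> entries gives the new
  abscissa, the row of the \<open>n\<close> entries the new height.\<close>

lemma orthogonal_transformation_real2:
  fixes R :: "real^2 \<Rightarrow> real^2"
  assumes "orthogonal_transformation R"
  obtains \<tau>1 \<tau>2 n1 n2 where
    "\<And>y. R y $ 1 = \<tau>1 * y $ 1 + \<tau>2 * y $ 2" "\<And>y. R y $ 2 = n1 * y $ 1 + n2 * y $ 2"
    "\<tau>1\<^sup>2 + n1\<^sup>2 = 1" "\<tau>2\<^sup>2 + n2\<^sup>2 = 1" "\<tau>1 * \<tau>2 + n1 * n2 = 0"
proof -
  let ?e1 = "axis 1 1 :: real^2" and ?e2 = "axis 2 1 :: real^2"
  have lin: "linear R" and inner: "\<And>v w. R v \<bullet> R w = v \<bullet> w"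
    using assms by (auto simp: orthogonal_transformation_def)
  have y: "y = y $ 1 *\<^sub>R ?e1 + y $ 2 *\<^sub>R ?e2" for y
    by (auto simp: vec_eq_iff forall_2 axis_def)
  have R: "R y = y $ 1 *\<^sub>R R ?e1 + y $ 2 *\<^sub>R R ?e2" for y
    by (subst y) (simp add: linear_add[OF lin] linear_scale[OF lin])
  show ?thesis
  proof (rule that[of "R ?e1 $ 1" "R ?e2 $ 1" "R ?e1 $ 2" "R ?e2 $ 2"])
    show "R y $ 1 = R ?e1 $ 1 * y $ 1 + R ?e2 $ 1 * y $ 2" for y by (subst R) (simp add: mult.commute)
    show "R y $ 2 = R ?e1 $ 2 * y $ 1 + R ?e2 $ 2 * y $ 2" for y by (subst R) (simp add: mult.commute)
    show "(R ?e1 $ 1)\<^sup>2 + (R ?e1 $ 2)\<^sup>2 = 1"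
      using inner[of ?e1 ?e1] by (simp add: inner_vec_def sum_2 power2_eq_square axis_def)
    show "(R ?e2 $ 1)\<^sup>2 + (R ?e2 $ 2)\<^sup>2 = 1"
      using inner[of ?e2 ?e2] by (simp add: inner_vec_def sum_2 power2_eq_square axis_def)
    show "R ?e1 $ 1 * R ?e2 $ 1 + R ?e1 $ 2 * R ?e2 $ 2 = 0"
      using inner[of ?e1 ?e2] by (simp add: inner_vec_def sum_2 axis_def)
  qed
qed

text \<open>Follow the slope \<open>p t\<close> of the rotated graph along the curve
  \<open>(t, u t)\<close>. Differentiating the graph equation gives
  \<open>u' t * (n2 - p t * \<tau>2) = (p t - p 0) * \<tau>1\<close>. The left side has order
  \<open>t powr a\<close>, since the bracket has a nonzero limit; the Hoelder condition makes the
  right side at most of order \<open>t powr b\<close>, which is smaller as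
  \<open>b > a\<close>.\<close>

lemma not_C1a_boundary_Eset:
  assumes a: "0 < a" "a < b" and V: "0 \<in> V"
  shows "\<not> C1a_boundary b (Eset a) V"
proof
  assume C1: "C1a_boundary b (Eset a) V"
  have "0 \<in> frontier (Eset a) \<inter> V" using zero_in_frontier_Eset[OF a(1)] V by simp
  from bspec[OF C1[unfolded C1a_boundary_def] this] obtain r and R :: "real^2 \<Rightarrow> real^2" and f f' :: "real \<Rightarrow> real" and C where r: "r > 0"
    and R: "orthogonal_transformation R"
    and f: "\<forall>t. (f has_real_derivative f' t) (at t)"
    and C: "\<forall>s\<in>{-r..r}. \<forall>t\<in>{-r..r}. \<bar>f' s - f' t\<bar> \<le> C * \<bar>s - t\<bar> powr b"
    and E: "Eset a \<inter> ball 0 r = {y \<in> ball 0 r. R (y - 0) $ 2 < f (R (y - 0) $ 1)}"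
    by (elim exE conjE) (rule that; assumption)
  note f = f[rule_format] and C = C[rule_format]
  obtain \<tau>1 \<tau>2 n1 n2 where R1: "\<And>y. R y $ 1 = \<tau>1 * y $ 1 + \<tau>2 * y $ 2"
    and R2: "\<And>y. R y $ 2 = n1 * y $ 1 + n2 * y $ 2"
    and orth: "\<tau>1\<^sup>2 + n1\<^sup>2 = 1" "\<tau>2\<^sup>2 + n2\<^sup>2 = 1" "\<tau>1 * \<tau>2 + n1 * n2 = 0"
    using orthogonal_transformation_real2[OF R] by blast
  define u where "u = spow (1 + a)"
  define u' where "u' = (\<lambda>t::real. (1 + a) * \<bar>t\<bar> powr a)"
  \<comment> \<open>As \<open>\<bar>u t\<bar> \<le> \<bar>t\<bar>\<close>, for
    \<open>\<bar>t\<bar> < \<delta>\<close> the curve stays in the ball and its rotated abscissa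
    stays in \<open>{-r..r}\<close>.\<close>
  define \<delta> where "\<delta> = min 1 (r / 2)"
  have \<delta>: "\<delta> > 0" "\<delta> \<le> 1" "2 * \<delta> \<le> r" using r by (auto simp: \<delta>_def)
  have u: "(u has_real_derivative u' t) (at t)" for t
    using DERIV_spow[of "1 + a" t] a by (simp add: u_def u'_def)
  have u_le: "\<bar>u t\<bar> \<le> \<bar>t\<bar>" if "\<bar>t\<bar> \<le> 1" for t
    using abs_spow_le[of "1 + a" t] a that by (simp add: u_def)
  have in_ball: "vector [t, y] \<in> ball (0::real^2) r" if "\<bar>t\<bar> + \<bar>y\<bar> < r" for t y
    using norm_le_l1_cart[of "vector [t, y] :: real^2"] that by (simp add: sum_2)
  have E_iff: "\<bar>t\<bar> < 1 \<and> \<bar>y\<bar> < 1 \<and> y < u t \<longleftrightarrow> n1 * t + n2 * y < f (\<tau>1 * t + \<tau>2 * y)"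
    if "\<bar>t\<bar> + \<bar>y\<bar> < r" for t y
  proof -
    have "vector [t, y] \<in> Eset a \<inter> ball 0 r \<longleftrightarrow>
        vector [t, y] \<in> {y \<in> ball 0 r. R (y - 0) $ 2 < f (R (y - 0) $ 1)}"
      unfolding E ..
    then show ?thesis using in_ball[OF that] by (simp add: Eset_iff R1 R2 u_def del: mem_ball)
  qed
  \<comment> \<open>The curve point itself is outside the set, since the defining inequality is
    strict; this gives one inequality. Points at depth \<open>s\<close> below it are inside, and
    \<open>s\<close> tending to 0 gives the other.\<close>
  have graph: "n1 * t + n2 * u t = f (\<tau>1 * t + \<tau>2 * u t)" if t: "\<bar>t\<bar> < \<delta>" for t
  proof (rule antisym)
    have sum: "\<bar>t\<bar> + \<bar>u t\<bar> < r" and t1: "\<bar>t\<bar> < 1" and ut1: "\<bar>u t\<bar> < 1" using t u_le[of t] \<delta> by auto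
    show "n1 * t + n2 * u t \<ge> f (\<tau>1 * t + \<tau>2 * u t)" using E_iff[OF sum] by auto
    have f_cont: "isCont f x" for x using f[of x] by (rule DERIV_isCont)
    have "((\<lambda>s. f (\<tau>1 * t + \<tau>2 * (u t - s)) - (n1 * t + n2 * (u t - s)))
        \<longlongrightarrow> f (\<tau>1 * t + \<tau>2 * (u t - 0)) - (n1 * t + n2 * (u t - 0))) (at_right 0)"
      by (intro tendsto_intros isCont_tendsto_compose[OF f_cont])
    moreover have "\<forall>\<^sub>F s in at_right 0. 0 \<le> f (\<tau>1 * t + \<tau>2 * (u t - s)) - (n1 * t + n2 * (u t - s))"
    proof -
      have pos: "0 < min (r - \<bar>t\<bar> - \<bar>u t\<bar>) (1 - \<bar>u t\<bar>)" using sum ut1 by auto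
      have "0 \<le> f (\<tau>1 * t + \<tau>2 * (u t - s)) - (n1 * t + n2 * (u t - s))"
        if "s \<in> {0<..<min (r - \<bar>t\<bar> - \<bar>u t\<bar>) (1 - \<bar>u t\<bar>)}" for s
      proof -
        have "\<bar>t\<bar> + \<bar>u t - s\<bar> < r" "\<bar>u t - s\<bar> < 1" "u t - s < u t" using that by auto
        then show ?thesis using E_iff[of t "u t - s"] t1 by simp
      qed
      then show ?thesis using eventually_at_right_real[OF pos] by (auto elim: eventually_mono)
    qed
    ultimately have "0 \<le> f (\<tau>1 * t + \<tau>2 * (u t - 0)) - (n1 * t + n2 * (u t - 0))"
      by (rule tendsto_lowerbound) simp
    then show "n1 * t + n2 * u t \<le> f (\<tau>1 * t + \<tau>2 * u t)" by simp
  qed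
  define p where "p = (\<lambda>t. f' (\<tau>1 * t + \<tau>2 * u t))"
  have slope: "n1 + n2 * u' t = p t * (\<tau>1 + \<tau>2 * u' t)" if t: "\<bar>t\<bar> < \<delta>" for t
  proof -
    have "((\<lambda>t. n1 * t + n2 * u t) has_real_derivative n1 + n2 * u' t) (at t)"
      by (auto intro!: derivative_eq_intros u)
    moreover have "((\<lambda>t. f (\<tau>1 * t + \<tau>2 * u t)) has_real_derivative p t * (\<tau>1 + \<tau>2 * u' t)) (at t)"
      unfolding p_def by (rule DERIV_chain'[OF _ f, THEN DERIV_cong]) (auto intro!: derivative_eq_intros u)
    then have "((\<lambda>t. n1 * t + n2 * u t) has_real_derivative p t * (\<tau>1 + \<tau>2 * u' t)) (at t)"
    proof (rule has_field_derivative_transform_within[where d = "\<delta> - \<bar>t\<bar>"])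
      fix s assume "dist s t < \<delta> - \<bar>t\<bar>"
      then have "\<bar>s\<bar> < \<delta>" by (simp add: dist_real_def)
      then show "f (\<tau>1 * s + \<tau>2 * u s) = n1 * s + n2 * u s" using graph by simp
    qed (use t in auto)
    ultimately show ?thesis by (rule DERIV_unique)
  qed
  \<comment> \<open>The original graph has slope 0 at the origin. Hence \<open>\<tau>1 = 0\<close>
    would force \<open>n1 = 0\<close>, against the unit length of the first column: the tangent is
    not vertical in the new frame.\<close>
  have p0: "n1 = p 0 * \<tau>1" using slope[of 0] \<delta>(1) a by (simp add: u'_def)
  have "\<tau>1 \<noteq> 0" using p0 orth(1) by auto
  \<comment> \<open>The product is the determinant of \<open>R\<close>, whose square is 1 by the
    Lagrange identity.\<close>
  have det: "(n2 - p 0 * \<tau>2) * \<tau>1 \<noteq> 0"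
  proof -
    have "(n2 * \<tau>1 - n1 * \<tau>2)\<^sup>2 = (\<tau>1\<^sup>2 + n1\<^sup>2) * (\<tau>2\<^sup>2 + n2\<^sup>2) - (\<tau>1 * \<tau>2 + n1 * n2)\<^sup>2"
      by (simp add: power2_eq_square algebra_simps)
    then have "n2 * \<tau>1 - n1 * \<tau>2 \<noteq> 0" using orth by auto
    then show ?thesis unfolding p0 by (simp add: algebra_simps)
  qed
  have le1: "\<bar>\<tau>1\<bar> \<le> 1" "\<bar>\<tau>2\<bar> \<le> 1"
    using orth(1,2) zero_le_power2[of n1] zero_le_power2[of n2] unfolding abs_square_le_1[symmetric]
    by linarith+
  have holder: "\<bar>p t - p 0\<bar> \<le> \<bar>C\<bar> * 2 powr b * t powr b" if t: "0 < t" "t < \<delta>" for t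
  proof -
    define z where "z = \<tau>1 * t + \<tau>2 * u t"
    have "\<bar>z\<bar> \<le> \<bar>\<tau>1\<bar> * \<bar>t\<bar> + \<bar>\<tau>2\<bar> * \<bar>u t\<bar>" unfolding z_def by (metis abs_mult abs_triangle_ineq)
    also have "\<dots> \<le> 1 * \<bar>t\<bar> + 1 * \<bar>t\<bar>" using le1 u_le[of t] t \<delta> by (intro add_mono mult_mono) auto
    finally have z: "\<bar>z\<bar> \<le> 2 * t" using t by simp
    have "\<bar>p t - p 0\<bar> \<le> C * \<bar>z - 0\<bar> powr b"
    proof -
      have "z \<in> {-r..r}" "0 \<in> {-r..r}" using z t \<delta> r by auto
      then show ?thesis using C[of z 0] by (simp add: p_def z_def u_def)
    qed
    also have "\<dots> \<le> \<bar>C\<bar> * (2 * t) powr b" using z a by (intro mult_mono powr_mono2) auto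
    finally show ?thesis using t by (simp add: powr_mult)
  qed
  have near: "\<forall>\<^sub>F t in at_right 0. 0 < t \<and> t < \<delta>"
    using eventually_at_right_real[OF \<delta>(1)] by (auto elim: eventually_mono)
  have t0: "((\<lambda>t::real. t powr c) \<longlongrightarrow> 0) (at_right 0)" if "c > 0" for c
  proof -
    have "((\<lambda>t::real. t powr c) \<longlongrightarrow> 0 powr c) (at_right 0)"
      using that near by (intro tendsto_powr' tendsto_intros) (auto elim: eventually_mono)
    then show ?thesis by simp
  qed
  have "((\<lambda>t. p t - p 0) \<longlongrightarrow> 0) (at_right 0)"
  proof (rule Lim_null_comparison)
    show "\<forall>\<^sub>F t in at_right 0. norm (p t - p 0) \<le> \<bar>C\<bar> * 2 powr b * t powr b"
      using near by eventually_elim (use holder in auto)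
    show "((\<lambda>t. \<bar>C\<bar> * 2 powr b * t powr b) \<longlongrightarrow> 0) (at_right 0)"
      using a by (intro tendsto_mult_right_zero t0) auto
  qed
  then have "(p \<longlongrightarrow> p 0) (at_right 0)" by (simp add: LIM_zero_iff)
  then have "((\<lambda>t. (1 + a) * \<bar>n2 - p t * \<tau>2\<bar>) \<longlongrightarrow> (1 + a) * \<bar>n2 - p 0 * \<tau>2\<bar>) (at_right 0)"
    by (intro tendsto_intros)
  moreover have "((\<lambda>t. \<bar>C\<bar> * 2 powr b * t powr (b - a)) \<longlongrightarrow> 0) (at_right 0)"
    using a by (intro tendsto_mult_right_zero t0) auto
  moreover have "\<forall>\<^sub>F t in at_right 0. (1 + a) * \<bar>n2 - p t * \<tau>2\<bar> \<le> \<bar>C\<bar> * 2 powr b * t powr (b - a)"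
    using near
  proof eventually_elim
    case (elim t)
    \<comment> \<open>The slope equation at \<open>t\<close>, with \<open>n1\<close> replaced by
      \<open>p 0 * \<tau>1\<close>. Taking moduli and dividing by \<open>t powr a\<close> leaves the
      positive power \<open>b - a\<close> on the right.\<close>
    have "u' t * (n2 - p t * \<tau>2) = (p t - p 0) * \<tau>1"
      using slope[of t] p0 elim by (simp add: algebra_simps)
    then have "\<bar>u' t\<bar> * \<bar>n2 - p t * \<tau>2\<bar> = \<bar>p t - p 0\<bar> * \<bar>\<tau>1\<bar>" by (metis abs_mult)
    also have "\<dots> \<le> (\<bar>C\<bar> * 2 powr b * t powr b) * 1" using holder[of t] elim le1 by (intro mult_mono) auto
    finally have "(1 + a) * \<bar>n2 - p t * \<tau>2\<bar> * t powr a \<le> \<bar>C\<bar> * 2 powr b * t powr b"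
      using elim a by (simp add: u'_def abs_mult mult_ac)
    then show ?case using elim by (simp add: powr_diff field_simps)
  qed
  ultimately have "(1 + a) * \<bar>n2 - p 0 * \<tau>2\<bar> \<le> 0"
    by (intro tendsto_le[OF trivial_limit_at_right_real])
  then show False using det a by (simp add: mult_le_0_iff)
qed

subsection \<open>The Gauss--Green formula on the set\<close>

lemma continuous_vector2 [continuous_intros]:
  assumes "continuous_on S f" "continuous_on S g"
  shows "continuous_on S (\<lambda>x. vector [f x, g x] :: real^2)"
proof -
  have "(\<lambda>x. vector [f x, g x] :: real^2) = (\<lambda>x. f x *\<^sub>R axis 1 1 + g x *\<^sub>R axis 2 1)"
    by (auto simp: fun_eq_iff vec_eq_iff forall_2 axis_def)
  then show ?thesis using assms by (simp only:) (intro continuous_intros)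
qed

lemma measurable_vector2:
  "(\<lambda>p. vector [fst p, snd p] :: real^2) \<in> lborel \<Otimes>\<^sub>M lborel \<rightarrow>\<^sub>M borel"
proof -
  have "(\<lambda>p::real\<times>real. vector [fst p, snd p] :: real^2) \<in> borel \<rightarrow>\<^sub>M borel"
    by (intro borel_measurable_continuous_onI continuous_intros)
  then show ?thesis by (simp add: lborel_prod)
qed

text \<open>Lebesgue measure is determined by its values on boxes, and a box pulls back to a product
  of intervals. This carries Fubini over from pairs to \<open>real^2\<close>.\<close>

lemma lborel_real2:
  "lborel = distr (lborel \<Otimes>\<^sub>M lborel) borel (\<lambda>p. vector [fst p, snd p] :: real^2)"
proof (rule lborel_eqI)
  fix l u :: "real^2"
  assume le: "\<And>b. b \<in> Basis \<Longrightarrow> l \<bullet> b \<le> u \<bullet> b"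
  have Basis2: "(Basis :: (real^2) set) = {axis 1 1, axis 2 1}"
    by (auto simp: Basis_vec_def UNIV_2)
  have ne: "axis 1 1 \<noteq> (axis 2 1 :: real^2)" by (simp add: axis_eq_axis)
  have le2: "l $ 1 \<le> u $ 1" "l $ 2 \<le> u $ 2" using le[of "axis 1 1"] le[of "axis 2 1"] by (auto simp: Basis2 inner_axis)
  have eq: "(\<lambda>p. vector [fst p, snd p] :: real^2) -` box l u \<inter> space (lborel \<Otimes>\<^sub>M lborel)
      = {l $ 1<..<u $ 1} \<times> {l $ 2<..<u $ 2}"
    by (auto simp: mem_box Basis2 inner_axis space_pair_measure)
  have "emeasure (distr (lborel \<Otimes>\<^sub>M lborel) borel (\<lambda>p. vector [fst p, snd p] :: real^2)) (box l u)
      = emeasure lborel {l $ 1<..<u $ 1} * emeasure lborel {l $ 2<..<u $ 2}"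
    by (subst emeasure_distr[OF measurable_vector2])
       (auto simp: eq intro!: lborel.emeasure_pair_measure_Times)
  also have "\<dots> = (\<Prod>b\<in>Basis. (u - l) \<bullet> b)"
    using le2 ne by (simp add: Basis2 inner_axis ennreal_mult)
  finally show "emeasure (distr (lborel \<Otimes>\<^sub>M lborel) borel (\<lambda>p. vector [fst p, snd p] :: real^2)) (box l u)
      = (\<Prod>b\<in>Basis. (u - l) \<bullet> b)" .
qed simp

text \<open>Each partial derivative has to be integrated first in its own variable, hence both
  orders.\<close>

lemma
  fixes f :: "real^2 \<Rightarrow> real"
  assumes f: "integrable lborel f"
  shows lborel_integral_real2_12: "integral\<^sup>L lborel f = (LBINT s. LBINT t. f (vector [s, t]))"
    and lborel_integral_real2_21: "integral\<^sup>L lborel f = (LBINT t. LBINT s. f (vector [s, t]))"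
proof -
  have fm: "f \<in> borel_measurable borel" using f by auto
  have int: "integrable (lborel \<Otimes>\<^sub>M lborel) (\<lambda>(s, t). f (vector [s, t]))"
    using f integrable_distr_eq[OF measurable_vector2 fm] by (simp add: lborel_real2[symmetric] case_prod_beta')
  have "integral\<^sup>L lborel f = integral\<^sup>L (lborel \<Otimes>\<^sub>M lborel) (\<lambda>(s, t). f (vector [s, t]))"
    using integral_distr[OF measurable_vector2 fm] by (simp add: lborel_real2[symmetric] case_prod_beta')
  then show "integral\<^sup>L lborel f = (LBINT s. LBINT t. f (vector [s, t]))"
    and "integral\<^sup>L lborel f = (LBINT t. LBINT s. f (vector [s, t]))"
    using lborel_pair.integral_fst[OF int] lborel_pair.integral_snd[OF int] by auto
qed

lemma integrable_real2_product:
  fixes f g :: "real \<Rightarrow> real"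
  assumes "integrable lborel f" "integrable lborel g"
  shows "integrable lborel (\<lambda>x::real^2. f (x $ 1) * g (x $ 2))"
proof -
  have "integrable (lborel \<Otimes>\<^sub>M lborel) (\<lambda>p. f (fst p) * g (snd p))"
    using assms by (intro lborel_pair.Fubini_integrable) (auto simp: abs_mult)
  moreover have "(\<lambda>x::real^2. f (x $ 1) * g (x $ 2)) \<in> borel_measurable borel"
    using assms by measurable
  ultimately show ?thesis
    using integrable_distr_eq[OF measurable_vector2, of "\<lambda>x. f (x $ 1) * g (x $ 2)"]
    by (simp add: lborel_real2[symmetric])
qed

lemma integrable_continuous_compact_support:
  fixes f :: "'a::euclidean_space \<Rightarrow> real"
  assumes "continuous_on UNIV f" "compact K" "\<And>x. x \<notin> K \<Longrightarrow> f x = 0"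
  shows "integrable lborel f"
proof -
  have "integrable lborel (\<lambda>x. indicator K x *\<^sub>R f x)"
    using assms(1,2) continuous_on_subset by (intro borel_integrable_compact) auto
  moreover have "(\<lambda>x. indicator K x *\<^sub>R f x) = f" using assms(3) by (auto simp: indicator_def fun_eq_iff)
  ultimately show ?thesis by simp
qed

lemma divergence_eq:
  assumes "(\<phi> has_derivative D) (at x)"
  shows "divergence \<phi> x = D (axis 1 1) $ 1 + D (axis 2 1) $ 2"
  using frechet_derivative_at[OF assms] by (simp add: divergence_def sum_2)

text \<open>The functions \<open>d1\<close> and \<open>d2\<close> are the diagonal entries of the
  Jacobian. Their derivatives along coordinate lines are what the one-dimensional fundamental
  theorem needs.\<close>

lemma test_field_partials:
  assumes "test_field U \<phi>"
  obtains d1 d2 K where "compact K" "K \<subseteq> U" "continuous_on UNIV d1" "continuous_on UNIV d2"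
    "\<And>x. x \<notin> K \<Longrightarrow> \<phi> x = 0 \<and> d1 x = 0 \<and> d2 x = 0" "\<And>x. divergence \<phi> x = d1 x + d2 x"
    "\<And>s t. ((\<lambda>t. \<phi> (vector [t, s]) $ 1) has_real_derivative d1 (vector [t, s])) (at t)"
    "\<And>s t. ((\<lambda>s. \<phi> (vector [t, s]) $ 2) has_real_derivative d2 (vector [t, s])) (at s)"
proof -
  obtain D K where D: "\<And>x. (\<phi> has_derivative D x) (at x)" "\<And>v. continuous_on UNIV (\<lambda>x. D x v)"
    and K: "compact K" "K \<subseteq> U" "\<And>x. x \<notin> K \<Longrightarrow> \<phi> x = 0"
    using assms unfolding test_field_def by metis
  \<comment> \<open>The complement of \<open>K\<close> is open, so the field vanishes near
    \<open>x\<close> and uniqueness of the derivative applies.\<close>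
  have D0: "D x = (\<lambda>_. 0)" if "x \<notin> K" for x
  proof (rule has_derivative_unique)
    have "open (- K)" using K(1) by (simp add: compact_imp_closed open_Compl)
    then show "(\<phi> has_derivative (\<lambda>_. 0)) (at x)"
      by (rule has_derivative_transform_within_open[OF has_derivative_const[of 0]]) (use that K(3) in auto)
  qed fact+
  have v: "(vector [t, s] :: real^2) = t *\<^sub>R axis 1 1 + s *\<^sub>R axis 2 1" for t s
    by (auto simp: vec_eq_iff forall_2 axis_def)
  have D1: "((\<lambda>t. \<phi> (vector [t, s])) has_derivative (\<lambda>h. D (vector [t, s]) (h *\<^sub>R axis 1 1))) (at t)" for s t
    by (rule has_derivative_compose[OF _ D(1)]) (auto simp: v intro!: derivative_eq_intros)
  have D2: "((\<lambda>s. \<phi> (vector [t, s])) has_derivative (\<lambda>h. D (vector [t, s]) (h *\<^sub>R axis 2 1))) (at s)" for s t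
    by (rule has_derivative_compose[OF _ D(1)]) (auto simp: v intro!: derivative_eq_intros)
  have lin: "linear (D x)" for x using D(1) has_derivative_linear by blast
  show ?thesis
  proof (rule that[of K "\<lambda>x. D x (axis 1 1) $ 1" "\<lambda>x. D x (axis 2 1) $ 2"])
    show "((\<lambda>t. \<phi> (vector [t, s]) $ 1) has_real_derivative D (vector [t, s]) (axis 1 1) $ 1) (at t)" for s t
      using bounded_linear.has_derivative[OF bounded_linear_vec_nth D1[of s t], of 1]
      by (simp add: has_field_derivative_def linear_scale[OF lin] mult_commute_abs)
    show "((\<lambda>s. \<phi> (vector [t, s]) $ 2) has_real_derivative D (vector [t, s]) (axis 2 1) $ 2) (at s)" for s t
      using bounded_linear.has_derivative[OF bounded_linear_vec_nth D2[of t s], of 2]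
      by (simp add: has_field_derivative_def linear_scale[OF lin] mult_commute_abs)
  qed (use K D(2) D0 divergence_eq[OF D(1)] in \<open>auto intro!: continuous_intros\<close>)
qed

lemma borel_Eset [measurable]: "Eset a \<in> sets borel"
proof -
  have "Eset a = {x \<in> space borel. \<bar>x $ 1\<bar> < 1 \<and> \<bar>x $ 2\<bar> < 1 \<and> x $ 2 < spow (1 + a) (x $ 1)}"
    by (auto simp: Eset_iff)
  also have "\<dots> \<in> sets borel" by measurable
  finally show ?thesis .
qed

text \<open>The two endpoints form a null set; the open form fits the sections of
  \<open>Eset\<close>, which are open intervals.\<close>

lemma LBINT_FTC_open:
  fixes F f :: "real \<Rightarrow> real"
  assumes "\<And>t. (F has_real_derivative f t) (at t)" "continuous_on UNIV f" "l \<le> h"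
  shows "(LBINT t. indicator {l<..<h} t * f t) = F h - F l"
proof -
  have "(LBINT t. f t * indicator {l..h} t) = F h - F l"
    using assms by (intro integral_FTC_Icc_real) (auto simp: continuous_on_eq_continuous_at)
  moreover have "(LBINT t. indicator {l<..<h} t * f t) = (LBINT t. f t * indicator {l..h} t)"
    by (rule integral_discrete_difference[where X = "{l, h}"])
       (use assms(3) in \<open>auto simp: indicator_def\<close>)
  ultimately show ?thesis by simp
qed

text \<open>Since \<open>u\<close> is increasing, \<open>E\<close> is also a graph domain over the \<open>x2\<close>-axis; so both partial derivatives
  can be integrated by Fubini and the fundamental theorem alone.\<close>
lemma integral_divergence_Eset:
  assumes a: "0 < a" and \<phi>: "test_field square \<phi>"
  shows "(LINT x:Eset a|lebesgue. divergence \<phi> x) =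
    (LBINT t:{-1..1}. \<phi> (vector [t, spow (1 + a) t]) $ 2
        - (1 + a) * \<bar>t\<bar> powr a * \<phi> (vector [t, spow (1 + a) t]) $ 1)"
proof -
  define u where "u = spow (1 + a)"
  \<comment> \<open>The inverse of \<open>u\<close>; it describes the same curve over the second
    axis.\<close>
  define g where "g = spow (1 / (1 + a))"
  have u_mono: "u s < u t \<longleftrightarrow> s < t" for s t using a by (simp add: u_def spow_mono_iff)
  have gu: "g (u t) = t" and ug: "u (g t) = t" for t using a by (auto simp: g_def u_def spow_spow)
  have u_bounds: "u t < 1 \<longleftrightarrow> t < 1" "- 1 < u t \<longleftrightarrow> - 1 < t" for t
    using a spow_bounds[of "1 + a" t] by (auto simp: u_def)
  have g_bounds: "g t < 1 \<longleftrightarrow> t < 1" "- 1 < g t \<longleftrightarrow> - 1 < t" for t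
    using a spow_bounds[of "1 / (1 + a)" t] by (auto simp: g_def)
  have u_cont: "continuous_on S u" for S using a by (simp add: u_def continuous_on_spow)
  have [measurable]: "g \<in> borel_measurable borel" unfolding g_def by measurable
  obtain d1 d2 K where K: "compact K" "K \<subseteq> square"
    and d: "continuous_on UNIV d1" "continuous_on UNIV d2"
    and off: "\<And>x. x \<notin> K \<Longrightarrow> \<phi> x = 0 \<and> d1 x = 0 \<and> d2 x = 0"
    and div: "\<And>x. divergence \<phi> x = d1 x + d2 x"
    and D1: "\<And>s t. ((\<lambda>t. \<phi> (vector [t, s]) $ 1) has_real_derivative d1 (vector [t, s])) (at t)"
    and D2: "\<And>s t. ((\<lambda>s. \<phi> (vector [t, s]) $ 2) has_real_derivative d2 (vector [t, s])) (at s)"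
    using test_field_partials[OF \<phi>] by metis
  have off': "\<phi> (vector [t, s]) = 0 \<and> d1 (vector [t, s]) = 0 \<and> d2 (vector [t, s]) = 0"
    if "\<not> (\<bar>t\<bar> < 1 \<and> \<bar>s\<bar> < 1)" for t s
  proof (rule off)
    show "vector [t, s] \<notin> K" using that K(2) by (auto simp: square_def forall_2 subset_iff)
  qed
  have \<phi>_cont: "continuous_on UNIV \<phi>" and \<phi>_le: "norm (\<phi> x) \<le> 1" for x
    using \<phi> has_derivative_continuous
    unfolding test_field_def continuous_on_eq_continuous_at[OF open_UNIV] by blast+
  have d_line: "continuous_on UNIV (\<lambda>t. d1 (vector [t, s]))" "continuous_on UNIV (\<lambda>t. d2 (vector [s, t]))" for s
    by (auto intro!: continuous_intros continuous_on_compose2[OF d(1)] continuous_on_compose2[OF d(2)])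
  have int: "integrable lborel (\<lambda>x. indicator (Eset a) x * d1 x)" "integrable lborel (\<lambda>x. indicator (Eset a) x * d2 x)"
    using integrable_continuous_compact_support[OF d(1) K(1)] integrable_continuous_compact_support[OF d(2) K(1)] off
    by (auto intro!: integrable_real_mult_indicator simp: mult.commute[of "indicator _ _"])
  \<comment> \<open>The vertical section at \<open>t\<close> runs from \<open>-1\<close> to
    \<open>u t\<close>, and the field vanishes at the lower end, on the side of the square.\<close>
  have I2: "(LBINT x. indicator (Eset a) x * d2 x) = (LBINT t. indicator {-1..1} t * \<phi> (vector [t, u t]) $ 2)"
    unfolding lborel_integral_real2_12[OF int(2)]
  proof (rule Bochner_Integration.integral_cong[OF refl])
    fix t :: real
    show "(LBINT s. indicator (Eset a) (vector [t, s]) * d2 (vector [t, s])) = indicator {-1..1} t * \<phi> (vector [t, u t]) $ 2"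
    proof (cases "\<bar>t\<bar> < 1")
      case True
      have "vector [t, s] \<in> Eset a \<longleftrightarrow> s \<in> {-1<..<u t}" for s
        using True u_bounds(1)[of t] by (auto simp: Eset_iff u_def[symmetric])
      then have "indicator (Eset a) (vector [t, s]) = (indicator {-1<..<u t} s :: real)" for s
        by (simp only: indicator_def)
      then have "(LBINT s. indicator (Eset a) (vector [t, s]) * d2 (vector [t, s]))
          = (LBINT s. indicator {-1<..<u t} s * d2 (vector [t, s]))" by simp
      also have "\<dots> = \<phi> (vector [t, u t]) $ 2 - \<phi> (vector [t, -1]) $ 2"
        using True u_bounds(2)[of t] by (intro LBINT_FTC_open D2 d_line) auto
      finally show ?thesis using True off'[of t "-1"] by (auto simp: indicator_def)
    qed (auto simp: off')
  qed
  \<comment> \<open>The horizontal section at height \<open>s\<close> runs from \<open>g s\<close>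
    to 1. Here the graph is the left end, whence the minus sign.\<close>
  have I1: "(LBINT x. indicator (Eset a) x * d1 x) = - (LBINT s. \<phi> (vector [g s, s]) $ 1 * indicator {-1..1} s)"
    unfolding lborel_integral_real2_21[OF int(1)] integral_minus[symmetric]
  proof (rule Bochner_Integration.integral_cong[OF refl])
    fix s :: real
    show "(LBINT t. indicator (Eset a) (vector [t, s]) * d1 (vector [t, s])) = - (\<phi> (vector [g s, s]) $ 1 * indicator {-1..1} s)"
    proof (cases "\<bar>s\<bar> < 1")
      case True
      have "- 1 < g s" using True g_bounds(2)[of s] by simp
      moreover have "s < u t \<longleftrightarrow> g s < t" for t using u_mono[of "g s" t] unfolding ug .
      ultimately have "\<bar>t\<bar> < 1 \<and> \<bar>s\<bar> < 1 \<and> s < u t \<longleftrightarrow> t \<in> {g s<..<1}" for t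
        unfolding abs_less_iff[of t] greaterThanLessThan_iff using True by (smt (verit))
      then have "vector [t, s] \<in> Eset a \<longleftrightarrow> t \<in> {g s<..<1}" for t
        unfolding Eset_iff vector_2 u_def .
      then have "indicator (Eset a) (vector [t, s]) = (indicator {g s<..<1} t :: real)" for t
        by (simp only: indicator_def)
      then have "(LBINT t. indicator (Eset a) (vector [t, s]) * d1 (vector [t, s]))
          = (LBINT t. indicator {g s<..<1} t * d1 (vector [t, s]))" by simp
      also have "\<dots> = \<phi> (vector [1, s]) $ 1 - \<phi> (vector [g s, s]) $ 1"
        using True g_bounds(1)[of s] by (intro LBINT_FTC_open D1 d_line) auto
      finally show ?thesis using True off'[of 1 s] by (auto simp: indicator_def)
    qed (auto simp: off')
  qed
  have u1: "u (- 1) = - 1" "u 1 = 1" by (auto simp: u_def spow_def)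
  have "set_integrable lborel {u (- 1)..u 1} (\<lambda>s. \<phi> (vector [g s, s]) $ 1)"
    unfolding set_integrable_def
  proof (rule integrableI_bounded_set_indicator[where B = 1])
    have "(\<lambda>p. \<phi> (vector [fst p, snd p]) $ 1) \<in> borel_measurable (borel :: (real \<times> real) measure)"
      by (intro borel_measurable_continuous_onI continuous_intros continuous_on_compose2[OF \<phi>_cont]) auto
    from measurable_compose[OF _ this, of "\<lambda>s. (g s, s)" lborel]
    show "(\<lambda>s. \<phi> (vector [g s, s]) $ 1) \<in> borel_measurable lborel"
      by (simp add: borel_prod[symmetric])
    show "AE s in lborel. s \<in> {u (- 1)..u 1} \<longrightarrow> norm (\<phi> (vector [g s, s]) $ 1) \<le> 1"
      by (intro AE_I2 impI) (simp add: order_trans[OF component_le_norm_cart \<phi>_le])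
  qed (auto simp: u1)
  note int_g = this
  have u'_cont: "continuous_on {-1..1} (\<lambda>t. (1 + a) * \<bar>t\<bar> powr a)"
    using a by (intro continuous_on_mult_left continuous_on_abs_powr)
  \<comment> \<open>Substituting \<open>s = u t\<close> turns \<open>g s\<close> into
    \<open>t\<close> and produces the slope as the Jacobian factor, so both integrals run over the
    same parameter.\<close>
  from integral_substitution(2)[where g = u and a = "-1" and b = 1 and g' = "\<lambda>t. (1 + a) * \<bar>t\<bar> powr a", OF int_g]
  have sub: "(LBINT s. \<phi> (vector [g s, s]) $ 1 * indicator {-1..1} s)
      = (LBINT t. \<phi> (vector [t, u t]) $ 1 * ((1 + a) * \<bar>t\<bar> powr a) * indicator {-1..1} t)"
    using a DERIV_spow[of "1 + a"] u'_cont unfolding u1 gu by (simp add: u_def)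
  have cont: "continuous_on {-1..1} (\<lambda>t. \<phi> (vector [t, u t]) $ 2)"
      "continuous_on {-1..1} (\<lambda>t. (1 + a) * \<bar>t\<bar> powr a * \<phi> (vector [t, u t]) $ 1)"
    using a by (auto intro!: continuous_intros continuous_on_compose2[OF \<phi>_cont] u_cont continuous_on_abs_powr)
  have ints: "integrable lborel (\<lambda>t. indicator {-1..1} t * \<phi> (vector [t, u t]) $ 2)"
      "integrable lborel (\<lambda>t. indicator {-1..1} t * ((1 + a) * \<bar>t\<bar> powr a * \<phi> (vector [t, u t]) $ 1))"
    using borel_integrable_compact[OF compact_Icc cont(1)] borel_integrable_compact[OF compact_Icc cont(2)] by auto
  have "(LINT x:Eset a|lebesgue. divergence \<phi> x) = (LBINT x. indicator (Eset a) x * d1 x + indicator (Eset a) x * d2 x)"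
  proof -
    have [measurable]: "d1 \<in> borel_measurable borel" "d2 \<in> borel_measurable borel"
      using d by (auto intro: borel_measurable_continuous_onI)
    have m: "(\<lambda>x. indicator (Eset a) x *\<^sub>R (d1 x + d2 x)) \<in> borel_measurable lborel" by measurable
    show ?thesis
      unfolding set_lebesgue_integral_def div integral_completion[OF m] by (simp add: algebra_simps)
  qed
  also have "\<dots> = (LBINT t. indicator {-1..1} t * \<phi> (vector [t, u t]) $ 2)
      - (LBINT t. indicator {-1..1} t * ((1 + a) * \<bar>t\<bar> powr a * \<phi> (vector [t, u t]) $ 1))"
    unfolding Bochner_Integration.integral_add[OF int] I1 I2 sub by (simp add: mult_ac)
  also have "\<dots> = (LBINT t:{-1..1}. \<phi> (vector [t, u t]) $ 2 - (1 + a) * \<bar>t\<bar> powr a * \<phi> (vector [t, u t]) $ 1)"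
    unfolding Bochner_Integration.integral_diff[OF ints, symmetric] set_lebesgue_integral_def
    by (simp add: algebra_simps)
  finally show ?thesis by (simp add: u_def)
qed

subsection \<open>Calibrations\<close>

lemma divergence_integrable:
  assumes "test_field U \<phi>"
  shows "integrable lebesgue (divergence \<phi>)"
proof -
  obtain d1 d2 K where K: "compact K" and d: "continuous_on UNIV d1" "continuous_on UNIV d2"
    and off: "\<And>x. x \<notin> K \<Longrightarrow> \<phi> x = 0 \<and> d1 x = 0 \<and> d2 x = 0" and div: "\<And>x. divergence \<phi> x = d1 x + d2 x"
    using test_field_partials[OF assms] by metis
  have "integrable lborel (\<lambda>x. d1 x + d2 x)"
    by (rule integrable_continuous_compact_support[OF _ K]) (use d off in \<open>auto intro!: continuous_intros\<close>)
  then have "integrable lborel (divergence \<phi>)" by (simp add: div[abs_def])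
  then show ?thesis by (simp add: integrable_completion borel_measurable_integrable)
qed

text \<open>For a competitor \<open>F\<close>, the perimeter of \<open>F\<close> is at least the
  integral of \<open>divergence (\<phi> n)\<close> over \<open>F\<close>. Write this as the integral
  over \<open>E\<close> plus that of the difference of indicators times the divergence. In the limit
  the two pieces become \<open>L\<close> and the integral of \<open>H\<close> over \<open>F\<close>
  minus that over \<open>E\<close>; since \<open>L\<close> dominates the perimeter of
  \<open>E\<close>, minimality follows.\<close>

lemma var_mean_curvature_calibration:
  assumes U: "open U" and E: "E \<in> sets lebesgue" "E \<subseteq> U"
    and H: "set_integrable lebesgue U H"
    and P_le: "perimeter E U \<le> ereal L"
    and \<phi>: "\<And>n. test_field U (\<phi> n)"
    and lim: "(\<lambda>n. LINT x:E|lebesgue. divergence (\<phi> n) x) \<longlonglongrightarrow> L"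
    and g: "set_integrable lebesgue U g"
    and dom: "\<And>K. compact K \<Longrightarrow> K \<subseteq> U \<Longrightarrow>
        \<forall>\<^sub>F n in sequentially. AE x in lebesgue. x \<in> K \<longrightarrow> \<bar>divergence (\<phi> n) x\<bar> \<le> g x"
    and conv: "\<And>K. compact K \<Longrightarrow> K \<subseteq> U \<Longrightarrow>
        AE x in lebesgue. x \<in> K \<longrightarrow> (\<lambda>n. divergence (\<phi> n) x) \<longlonglongrightarrow> H x"
  shows "var_mean_curvature E U H"
  unfolding var_mean_curvature_def finite_perimeter_in_def
proof (intro conjI allI impI)
  show "perimeter E U < \<infinity>" using P_le by (cases "perimeter E U") auto
  fix F assume F: "F \<in> sets lebesgue" and "\<exists>K. compact K \<and> K \<subseteq> U \<and> sym_diff F E \<subseteq> K"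
  then obtain K where K: "compact K" "K \<subseteq> U" and FE: "sym_diff F E \<subseteq> K" by blast
  have FU: "F \<subseteq> U" using E K FE by blast
  \<comment> \<open>This weight vanishes off \<open>K\<close>, so domination and convergence are
    needed on \<open>K\<close> alone.\<close>
  define s :: "real^2 \<Rightarrow> real" where "s = (\<lambda>x. indicator F x - indicator E x)"
  have s0: "s x = 0" if "x \<notin> K" for x using that FE by (auto simp: s_def indicator_def)
  have s1: "\<bar>s x\<bar> \<le> 1" for x by (auto simp: s_def indicator_def)
  have [measurable]: "s \<in> borel_measurable lebesgue" using F E by (simp add: s_def)
  have Kleb: "K \<in> sets lebesgue" using K(1) by (simp add: lmeasurable_compact fmeasurableD)
  have gK: "set_integrable lebesgue K g" and HK: "set_integrable lebesgue K H"
    using g H K(2) Kleb by (auto intro: set_integrable_subset)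
  have [measurable]: "divergence (\<phi> n) \<in> borel_measurable lebesgue" for n
    using divergence_integrable[OF \<phi>] by (rule borel_measurable_integrable)
  obtain N where N: "\<And>n. n \<ge> N \<Longrightarrow> AE x in lebesgue. x \<in> K \<longrightarrow> \<bar>divergence (\<phi> n) x\<bar> \<le> g x"
    using dom[OF K] unfolding eventually_sequentially by blast
  \<comment> \<open>Integrability of \<open>H\<close> on a set gives measurability only after
    multiplication by an indicator.\<close>
  have sH: "(\<lambda>x. s x * H x) = (\<lambda>x. s x * (indicator K x *\<^sub>R H x))"
    using s0 by (fastforce simp: indicator_def)
  \<comment> \<open>The bound \<open>g\<close> holds from index \<open>N\<close> on, hence the
    shifted sequence.\<close>
  have "(\<lambda>n. LINT x|lebesgue. s x * divergence (\<phi> (n + N)) x) \<longlonglongrightarrow> (LINT x|lebesgue. s x * H x)"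
  proof (rule integral_dominated_convergence)
    show "integrable lebesgue (\<lambda>x. indicator K x *\<^sub>R g x)" using gK by (simp add: set_integrable_def)
    show "(\<lambda>x. s x * H x) \<in> borel_measurable lebesgue"
      using HK unfolding sH set_integrable_def by (intro borel_measurable_times) auto
    show "AE x in lebesgue. (\<lambda>n. s x * divergence (\<phi> (n + N)) x) \<longlonglongrightarrow> s x * H x"
      using conv[OF K]
    proof eventually_elim
      case (elim x)
      show ?case
      proof (cases "x \<in> K")
        case True
        then show ?thesis using elim by (intro tendsto_mult_left LIMSEQ_ignore_initial_segment) auto
      qed (simp add: s0)
    qed
    show "AE x in lebesgue. norm (s x * divergence (\<phi> (n + N)) x) \<le> indicator K x *\<^sub>R g x" for n
      using N[of "n + N", OF le_add2]
    proof eventually_elim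
      case (elim x)
      show ?case
      proof (cases "x \<in> K")
        case True
        then show ?thesis using elim s1[of x] mult_mono[of "\<bar>s x\<bar>" 1 "\<bar>divergence (\<phi> (n + N)) x\<bar>" "g x"]
          by (simp add: abs_mult)
      qed (simp add: s0)
    qed
  qed auto
  moreover have "(LINT x|lebesgue. s x * H x) = (LINT x:F|lebesgue. H x) - (LINT x:E|lebesgue. H x)"
    using set_integrable_subset[OF H F FU] set_integrable_subset[OF H E]
    unfolding set_lebesgue_integral_def set_integrable_def
    by (subst Bochner_Integration.integral_diff[symmetric]) (auto simp: s_def algebra_simps)
  moreover have "(LINT x|lebesgue. s x * divergence (\<phi> n) x)
      = (LINT x:F|lebesgue. divergence (\<phi> n) x) - (LINT x:E|lebesgue. divergence (\<phi> n) x)" for n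
    using integrable_mult_indicator[OF F divergence_integrable[OF \<phi>]] integrable_mult_indicator[OF E(1) divergence_integrable[OF \<phi>]]
    unfolding set_lebesgue_integral_def
    by (subst Bochner_Integration.integral_diff[symmetric]) (auto simp: s_def algebra_simps)
  ultimately have "(\<lambda>n. ((LINT x:F|lebesgue. divergence (\<phi> (n + N)) x) - (LINT x:E|lebesgue. divergence (\<phi> (n + N)) x))
        + (LINT x:E|lebesgue. divergence (\<phi> (n + N)) x))
      \<longlonglongrightarrow> ((LINT x:F|lebesgue. H x) - (LINT x:E|lebesgue. H x)) + L"
    using LIMSEQ_ignore_initial_segment[OF lim, of N] by (intro tendsto_add) auto
  then have lim_F: "(\<lambda>n. ereal (LINT x:F|lebesgue. divergence (\<phi> (n + N)) x))
      \<longlonglongrightarrow> ereal ((LINT x:F|lebesgue. H x) - (LINT x:E|lebesgue. H x) + L)"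
    by simp
  have "ereal (LINT x:F|lebesgue. divergence (\<phi> n) x) \<le> perimeter F U" for n
    unfolding perimeter_def using \<phi> by (intro SUP_upper) simp
  then have F_ge: "ereal ((LINT x:F|lebesgue. H x) - (LINT x:E|lebesgue. H x) + L) \<le> perimeter F U"
    by (intro LIMSEQ_le_const2[OF lim_F]) blast
  have "E \<inter> U = E" "F \<inter> U = F" using E FU by auto
  then show "perimeter E U - ereal (LINT x:(E \<inter> U)|lebesgue. H x)
        \<le> perimeter F U - ereal (LINT x:(F \<inter> U)|lebesgue. H x)"
    using F_ge P_le by (cases "perimeter E U"; cases "perimeter F U") auto
qed (use U E H in auto)

lemma test_fieldI:
  fixes f g :: "real^2 \<Rightarrow> real"
  assumes f: "\<And>x. (f has_derivative (\<lambda>h. f1 x * h $ 1 + f2 x * h $ 2)) (at x)"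
    and g: "\<And>x. (g has_derivative (\<lambda>h. g1 x * h $ 1 + g2 x * h $ 2)) (at x)"
    and cont: "continuous_on UNIV f1" "continuous_on UNIV f2" "continuous_on UNIV g1" "continuous_on UNIV g2"
    and K: "compact K" "K \<subseteq> U" "\<And>x. x \<notin> K \<Longrightarrow> f x = 0 \<and> g x = 0"
    and le: "\<And>x. (f x)\<^sup>2 + (g x)\<^sup>2 \<le> 1"
  shows "test_field U (\<lambda>x. vector [f x, g x])" "divergence (\<lambda>x. vector [f x, g x]) x = f1 x + g2 x"
proof -
  define D :: "real^2 \<Rightarrow> real^2 \<Rightarrow> real^2" where
    "D = (\<lambda>x h. (f1 x * h $ 1 + f2 x * h $ 2) *\<^sub>R axis 1 1 + (g1 x * h $ 1 + g2 x * h $ 2) *\<^sub>R axis 2 1)"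
  have v: "(vector [s, t] :: real^2) = s *\<^sub>R axis 1 1 + t *\<^sub>R axis 2 1" for s t
    by (auto simp: vec_eq_iff forall_2 axis_def)
  have D: "((\<lambda>x. vector [f x, g x]) has_derivative D x) (at x)" for x
    unfolding v D_def by (intro has_derivative_add has_derivative_scaleR_left f g)
  have "continuous_on UNIV (\<lambda>x. D x h)" for h
    unfolding D_def using cont by (intro continuous_intros)
  moreover have "norm (vector [f x, g x] :: real^2) \<le> 1" for x
    using le[of x] by (simp add: norm_vec_def L2_set_def sum_2 real_sqrt_le_1_iff)
  moreover have "(vector [0, 0] :: real^2) = 0" by (simp add: vec_eq_iff forall_2)
  ultimately show "test_field U (\<lambda>x. vector [f x, g x])"
    unfolding test_field_def using D K by (intro conjI exI[of _ D] exI[of _ K]) auto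
  show "divergence (\<lambda>x. vector [f x, g x]) x = f1 x + g2 x"
    using divergence_eq[OF D, of x] by (simp add: D_def axis_def)
qed

subsection \<open>The calibrating field\<close>

text \<open>Suffixes 1 and 2 denote the partial derivatives of \<open>cal_slope\<close>; \<open>cal_curv\<close> is the divergence of
  the regularized \<open>X\<close>, and \<open>H\<close> is its value at \<open>e = 0\<close>.\<close>
definition cal_weight :: "real \<Rightarrow> real \<Rightarrow> real^2 \<Rightarrow> real" where
  "cal_weight a e x = (\<bar>x $ 1\<bar> powr (2 + 2 * a) + (x $ 2)\<^sup>2 + e) / 2"

definition cal_slope :: "real \<Rightarrow> real \<Rightarrow> real^2 \<Rightarrow> real" where
  "cal_slope a e x = (1 + a) * cal_weight a e x powr (a / (2 + 2 * a))"

definition cal_slope1 :: "real \<Rightarrow> real \<Rightarrow> real^2 \<Rightarrow> real" where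
  "cal_slope1 a e x = a / 2 * cal_weight a e x powr (a / (2 + 2 * a) - 1) * ((1 + a) * spow (1 + 2 * a) (x $ 1))"

definition cal_slope2 :: "real \<Rightarrow> real \<Rightarrow> real^2 \<Rightarrow> real" where
  "cal_slope2 a e x = a / 2 * cal_weight a e x powr (a / (2 + 2 * a) - 1) * x $ 2"

definition cal_curv :: "real \<Rightarrow> real \<Rightarrow> real^2 \<Rightarrow> real" where
  "cal_curv a e x = - (cal_slope1 a e x + cal_slope a e x * cal_slope2 a e x) / sqrt (1 + (cal_slope a e x)\<^sup>2) ^ 3"

text \<open>A majorant independent of \<open>e\<close>, in product form so that its integral splits
  into one-dimensional ones. Since \<open>0 powr\<close> anything is 0, it vanishes on the axes and
  is used as a bound only off them.\<close>

definition cal_bound :: "real \<Rightarrow> real^2 \<Rightarrow> real" where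
  "cal_bound a x = 8 * (\<bar>x $ 1\<bar> powr - ((1 - a) / (2 + a)) * \<bar>x $ 2\<bar> powr - ((1 - a) / (2 + a)))"

lemma cal_weight_pos: "0 < e \<Longrightarrow> 0 < cal_weight a e x"
  unfolding cal_weight_def by (intro divide_pos_pos add_nonneg_pos add_nonneg_nonneg) auto

lemma cal_weight_0_pos: "x $ 1 \<noteq> 0 \<Longrightarrow> 0 < cal_weight a 0 x"
  unfolding cal_weight_def by (intro divide_pos_pos add_pos_nonneg) auto

text \<open>With \<open>W\<close> the weight, both terms of the numerator of \<open>cal_curv\<close>
  are at most \<open>2 * W powr - k\<close>, the exponent dictated by the anisotropic scaling. Then
  \<open>2 * W\<close> dominates each of \<open>A\<close> and \<open>B\<close>, hence their weighted
  geometric mean. The parameter \<open>e\<close> only enlarges \<open>W\<close>, so the bound is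
  uniform in it.\<close>

lemma abs_cal_curv_le_bound:
  assumes a: "0 < a" "a < 1" and e: "0 \<le> e" and x: "x $ 1 \<noteq> 0" "x $ 2 \<noteq> 0"
  shows "\<bar>cal_curv a e x\<bar> \<le> cal_bound a x"
proof -
  define W where "W = cal_weight a e x"
  define A B where "A = \<bar>x $ 1\<bar> powr (2 + 2 * a)" and "B = \<bar>x $ 2\<bar> powr 2"
  have AB: "0 < A" "0 < B" using x by (auto simp: A_def B_def)
  have W2: "2 * W = A + B + e" using x by (simp add: W_def cal_weight_def A_def B_def powr_numeral)
  have W: "0 < W" "A \<le> 2 * W" "B \<le> 2 * W" using W2 AB e by auto
  define g where "g = a / (2 + 2 * a)"
  define k where "k = (1 - a) / (2 + 2 * a)"
  have k: "0 \<le> k" "k \<le> 1" using a by (auto simp: k_def)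
  have two: "2 powr c \<le> 2" if "c \<le> 1" for c :: real using powr_mono[OF that, of 2] by simp
  have aa: "a * (1 + a) \<le> 1 * 2" using a by (intro mult_mono) auto
  have s1: "\<bar>cal_slope1 a e x\<bar> \<le> 2 * W powr - k"
  proof -
    \<comment> \<open>Chosen so that \<open>\<bar>x $ 1\<bar> powr (1 + 2 * a)\<close> equals
      \<open>A powr c\<close>.\<close>
    define c where "c = (1 + 2 * a) / (2 + 2 * a)"
    have c: "0 \<le> c" "c \<le> 1" using a by (auto simp: c_def)
    have "\<bar>x $ 1\<bar> powr (1 + 2 * a) = A powr c" using a by (simp add: A_def c_def powr_powr)
    also have "\<dots> \<le> (2 * W) powr c" using W AB c by (intro powr_mono2) auto
    also have "\<dots> = 2 powr c * W powr c" using W by (simp add: powr_mult)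
    also have "\<dots> \<le> 2 * W powr c" using two[OF c(2)] by (intro mult_right_mono) auto
    finally have x1: "\<bar>x $ 1\<bar> powr (1 + 2 * a) \<le> 2 * W powr c" .
    have "\<bar>cal_slope1 a e x\<bar> = a / 2 * W powr (g - 1) * ((1 + a) * \<bar>x $ 1\<bar> powr (1 + 2 * a))"
      using a by (simp add: cal_slope1_def abs_mult abs_spow W_def g_def)
    also have "\<dots> \<le> a / 2 * W powr (g - 1) * ((1 + a) * (2 * W powr c))"
      using a x1 by (intro mult_left_mono) auto
    also have "\<dots> = a * (1 + a) * W powr (g - 1 + c)" by (simp add: powr_add)
    also have "g - 1 + c = - k"
    proof -
      have "g + c + k = (a + (1 + 2 * a) + (1 - a)) / (2 + 2 * a)"
        by (simp only: g_def c_def k_def add_divide_distrib)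
      also have "\<dots> = 1" using a by simp
      finally show ?thesis by simp
    qed
    also have "a * (1 + a) * W powr - k \<le> 2 * W powr - k" using aa by (intro mult_right_mono) auto
    finally show ?thesis .
  qed
  have s2: "\<bar>cal_slope a e x * cal_slope2 a e x\<bar> \<le> 2 * W powr - k"
  proof -
    have "\<bar>x $ 2\<bar> = B powr (1 / 2)" by (simp add: B_def powr_powr)
    also have "\<dots> \<le> (2 * W) powr (1 / 2)" using W AB by (intro powr_mono2) auto
    also have "\<dots> = 2 powr (1 / 2) * W powr (1 / 2)" using W by (simp add: powr_mult)
    also have "\<dots> \<le> 2 * W powr (1 / 2)" using two[of "1/2"] by (intro mult_right_mono) auto
    finally have x2: "\<bar>x $ 2\<bar> \<le> 2 * W powr (1 / 2)" .
    have "\<bar>cal_slope a e x * cal_slope2 a e x\<bar> = (1 + a) * W powr g * (a / 2 * W powr (g - 1) * \<bar>x $ 2\<bar>)"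
      using a by (simp add: cal_slope_def cal_slope2_def abs_mult W_def g_def)
    also have "\<dots> \<le> (1 + a) * W powr g * (a / 2 * W powr (g - 1) * (2 * W powr (1 / 2)))"
      using a x2 by (intro mult_left_mono) auto
    also have "\<dots> = a * (1 + a) * W powr (g + (g - 1) + 1 / 2)" by (simp only: powr_add) simp
    also have "g + (g - 1) + 1 / 2 = - k" using a by (simp add: g_def k_def field_simps)
    also have "a * (1 + a) * W powr - k \<le> 2 * W powr - k" using aa by (intro mult_right_mono) auto
    finally show ?thesis .
  qed
  \<comment> \<open>The denominator of \<open>cal_curv\<close> is at least 1 and is dropped.\<close>
  have "\<bar>cal_curv a e x\<bar> \<le> \<bar>cal_slope1 a e x + cal_slope a e x * cal_slope2 a e x\<bar> / 1"
  proof -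
    have "1 \<le> sqrt (1 + (cal_slope a e x)\<^sup>2) ^ 3" by (intro one_le_power) simp
    then show ?thesis unfolding cal_curv_def abs_divide abs_minus_cancel by (intro divide_left_mono) (auto intro!: add_pos_nonneg)
  qed
  also have "\<dots> \<le> 4 * W powr - k" using s1 s2 abs_triangle_ineq[of "cal_slope1 a e x" "cal_slope a e x * cal_slope2 a e x"] by simp
  also have "\<dots> = 4 * (2 powr k * (2 * W) powr - k)" using W by (simp add: powr_mult powr_minus)
  also have "\<dots> \<le> 4 * (2 * (2 * W) powr - k)" using two[OF k(2)] by (intro mult_left_mono mult_right_mono) auto
  also have "(2 * W) powr - k \<le> \<bar>x $ 1\<bar> powr - ((1 - a) / (2 + a)) * \<bar>x $ 2\<bar> powr - ((1 - a) / (2 + a))"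
  proof -
    \<comment> \<open>The weight for which both coordinates receive the same exponent: it solves
      \<open>(2 + 2 * a) * t = 2 * (1 - t)\<close>.\<close>
    define t where "t = 1 / (2 + a)"
    have t: "0 \<le> t" "t \<le> 1" using a by (auto simp: t_def)
    have "A powr t * B powr (1 - t) \<le> (2 * W) powr t * (2 * W) powr (1 - t)"
      using W AB t by (intro mult_mono powr_mono2) auto
    also have "\<dots> = 2 * W" using W by (simp flip: powr_add)
    finally have "(2 * W) powr - k \<le> (A powr t * B powr (1 - t)) powr - k"
      using k AB by (intro powr_mono2') auto
    also have "\<dots> = (A powr t) powr - k * (B powr (1 - t)) powr - k"
      by (rule powr_mult)
    also have "(A powr t) powr - k = \<bar>x $ 1\<bar> powr - ((1 - a) / (2 + a))"
    proof -
      have "(2 + 2 * a) * t * - k = - ((1 - a) / (2 + a))" using a by (simp add: t_def k_def)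
      then show ?thesis by (simp add: A_def powr_powr)
    qed
    also have "(B powr (1 - t)) powr - k = \<bar>x $ 2\<bar> powr - ((1 - a) / (2 + a))"
    proof -
      have "1 - t = (1 + a) / (2 + a)" using a by (simp add: t_def field_simps)
      moreover have "2 * ((1 + a) / (2 + a)) * k = (1 - a) / (2 + a)"
      proof -
        have "2 * (1 + a) * k = 1 - a" using a by (simp add: k_def)
        then show ?thesis by (metis times_divide_eq_left times_divide_eq_right)
      qed
      ultimately have "2 * (1 - t) * - k = - ((1 - a) / (2 + a))" by simp
      then show ?thesis by (simp only: B_def powr_powr)
    qed
    finally show ?thesis .
  qed
  finally show ?thesis by (simp add: cal_bound_def)
qed

section \<open>Integrability of the majorant\<close>

lemma integrable_abs_powr:
  fixes c :: real
  assumes "- 1 < c"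
  shows "integrable lborel (\<lambda>t. indicator {-1<..<1} t * \<bar>t\<bar> powr c)"
proof -
  have "(\<lambda>t. t powr c) absolutely_integrable_on {0..1}"
    using has_integral_powr_from_0[OF assms, of 1]
    by (intro nonnegative_absolutely_integrable_1) (auto simp: integrable_on_def)
  then have "integrable lebesgue (\<lambda>t. indicator {0..1} t *\<^sub>R t powr c)" by (simp add: set_integrable_def)
  then have 1: "integrable lborel (\<lambda>t. indicator {0..1} t *\<^sub>R t powr c)"
    by (subst (asm) integrable_completion) auto
  \<comment> \<open>Reflection supplies the negative half; the sum of the two halves dominates the
    integrand.\<close>
  then have 2: "integrable lborel (\<lambda>t. indicator {0..1} (- t) *\<^sub>R (- t) powr c)"
    using lborel_integrable_real_affine[OF 1, of "- 1" 0] by simp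
  show ?thesis
    by (rule Bochner_Integration.integrable_bound[OF Bochner_Integration.integrable_add[OF 1 2]])
       (auto simp: indicator_def)
qed

text \<open>The \<open>p\<close>-th power is a product of one-variable powers with exponent
  \<open>- ((1 - a) / (2 + a) * p)\<close>, which exceeds \<open>-1\<close> exactly when
  \<open>p * (1 - a) < 2 + a\<close>.\<close>

lemma integrable_cal_bound:
  assumes a: "0 < a" "a < 1" and p: "0 \<le> p" "p * (1 - a) < 2 + a"
  shows "set_integrable lebesgue square (\<lambda>x. cal_bound a x powr p)"
proof -
  define c where "c = - ((1 - a) / (2 + a) * p)"
  have c: "- 1 < c" using a p by (simp add: c_def field_simps)
  define f where "f = (\<lambda>t::real. indicator {-1<..<1} t * \<bar>t\<bar> powr c)"
  have "integrable lborel (\<lambda>x::real^2. 8 powr p * (f (x $ 1) * f (x $ 2)))"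
    using integrable_abs_powr[OF c] unfolding f_def
    by (intro integrable_mult_right integrable_real2_product)
  moreover have "8 powr p * (f (x $ 1) * f (x $ 2)) = indicator square x *\<^sub>R cal_bound a x powr p" for x
    by (auto simp: f_def c_def cal_bound_def powr_mult powr_powr square_def forall_2 indicator_def abs_less_iff)
  ultimately show ?thesis
    unfolding set_integrable_def by (simp add: integrable_completion borel_measurable_integrable)
qed

lemma AE_coords_nonzero: "AE x::real^2 in lebesgue. x $ 1 \<noteq> 0 \<and> x $ 2 \<noteq> 0"
proof -
  have "AE x in lebesgue. x \<notin> {x::real^2. x $ i = 0}" for i
    using negligible_standard_hyperplane_cart[of i] negligible_iff_null_sets AE_not_in by blast
  from this[of 1] this[of 2] show ?thesis by eventually_elim auto
qed

lemma borel_measurable_cal_curv: "cal_curv a e \<in> borel_measurable borel"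
  unfolding cal_curv_def[abs_def] cal_slope_def cal_slope1_def cal_slope2_def cal_weight_def by measurable

text \<open>A step from 0 on the negative axis to 1 beyond 1. Squares of positive parts are of class
  \<open>C^1\<close>, which is all the smoothness that \<open>test_field\<close> asks for.\<close>

definition bump :: "real \<Rightarrow> real" where
  "bump s = 1 - (max 0 (1 - (max 0 s)\<^sup>2))\<^sup>2"

definition bump' :: "real \<Rightarrow> real" where
  "bump' s = 4 * max 0 (1 - (max 0 s)\<^sup>2) * max 0 s"

text \<open>The squared positive part is the mean of \<open>x\<close> squared and
  \<open>spow 2 x\<close>, which avoids a case split at 0.\<close>

lemma DERIV_max_0_sq: "((\<lambda>x::real. (max 0 x)\<^sup>2) has_real_derivative 2 * max 0 x) (at x)"
proof -
  have "(\<lambda>x::real. (max 0 x)\<^sup>2) = (\<lambda>x. (x\<^sup>2 + spow 2 x) / 2)"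
    by (auto simp: fun_eq_iff spow_def max_def sgn_if power2_eq_square powr_numeral)
  moreover have "((\<lambda>x. (x\<^sup>2 + spow 2 x) / 2) has_real_derivative (2 * x + 2 * \<bar>x\<bar> powr (2 - 1)) / 2) (at x)"
    by (auto intro!: derivative_eq_intros DERIV_spow)
  moreover have "(2 * x + 2 * \<bar>x\<bar> powr (2 - 1)) / 2 = 2 * max 0 x"
    by (auto simp: max_def)
  ultimately show ?thesis by metis
qed

lemma DERIV_bump: "(bump has_real_derivative bump' s) (at s)"
proof -
  have "((\<lambda>s. 1 - (max 0 s)\<^sup>2) has_real_derivative 0 - 2 * max 0 s) (at s)"
    by (intro DERIV_diff DERIV_const DERIV_max_0_sq)
  from DERIV_diff[OF DERIV_const[of 1] DERIV_chain2[OF DERIV_max_0_sq this]]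
  show ?thesis by (rule DERIV_cong[THEN back_subst[of "\<lambda>f. (f has_real_derivative bump' s) (at s)"]])
     (auto simp: bump_def[abs_def] bump'_def)
qed

lemma bump_bounds: "0 \<le> bump s" "bump s \<le> 1"
proof -
  have "(max 0 (1 - (max 0 s)\<^sup>2))\<^sup>2 \<le> 1" by (intro power_le_one) auto
  then show "0 \<le> bump s" "bump s \<le> 1" by (auto simp: bump_def)
qed

lemma bump_eq_0: "s \<le> 0 \<Longrightarrow> bump s = 0"
  by (simp add: bump_def max_absorb1)

lemma bump_eq_1:
  assumes "1 \<le> s"
  shows "bump s = 1" "bump' s = 0"
proof -
  have "max 0 (1 - (max 0 s)\<^sup>2) = 0"
    using one_le_power[of s 2] assms by (simp add: max_absorb1 max_absorb2)
  then show "bump s = 1" "bump' s = 0" by (simp_all add: bump_def bump'_def)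
qed

lemma continuous_on_bump': "continuous_on S bump'"
  unfolding bump'_def[abs_def] by (intro continuous_intros)

text \<open>For \<open>n > 0\<close> it is 0 where \<open>1 - t\<^sup>2 \<le> 1 / n\<close> and 1
  where \<open>1 - t\<^sup>2 \<ge> 2 / n\<close>: compactly supported in the open interval, and
  eventually 1 on each compact part of it.\<close>

definition cutoff :: "real \<Rightarrow> real \<Rightarrow> real" where
  "cutoff n t = bump (n * (1 - t\<^sup>2) - 1)"

definition cutoff' :: "real \<Rightarrow> real \<Rightarrow> real" where
  "cutoff' n t = bump' (n * (1 - t\<^sup>2) - 1) * (- 2 * n * t)"

lemma DERIV_cutoff: "(cutoff n has_real_derivative cutoff' n t) (at t)"
proof -
  have "((\<lambda>t. n * (1 - t\<^sup>2) - 1) has_real_derivative - 2 * n * t) (at t)"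
    by (auto intro!: derivative_eq_intros)
  from DERIV_chain2[OF DERIV_bump this] show ?thesis by (simp add: cutoff_def[abs_def] cutoff'_def)
qed

lemma continuous_on_cutoff: "continuous_on S (cutoff n)"
  by (rule DERIV_continuous_on) (rule DERIV_cutoff[THEN has_field_derivative_at_within])

lemma continuous_on_cutoff': "continuous_on S (cutoff' n)"
  unfolding cutoff'_def[abs_def] by (intro continuous_intros continuous_on_compose2[OF continuous_on_bump'[of UNIV]]) auto

lemma cutoff_eq_1:
  assumes "2 \<le> n * (1 - t\<^sup>2)"
  shows "cutoff n t = 1" "cutoff' n t = 0"
  using assms by (auto simp: cutoff_def cutoff'_def bump_eq_1)

lemma eventually_two_le_one_minus_sq:
  fixes r :: real
  assumes "r < 1"
  shows "\<forall>\<^sub>F n in sequentially. \<forall>t. \<bar>t\<bar> \<le> r \<longrightarrow> 2 \<le> real (Suc n) * (1 - t\<^sup>2)"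
proof (cases "0 \<le> r")
  case True
  have r: "0 < 1 - r\<^sup>2" using assms True by (simp add: power_less_one_iff abs_square_less_1)
  have "\<forall>\<^sub>F n in sequentially. 2 / (1 - r\<^sup>2) \<le> real n"
    using filterlim_real_sequentially by (simp add: filterlim_at_top)
  then show ?thesis
  proof eventually_elim
    case (elim n)
    show ?case
    proof (intro allI impI)
      fix t :: real assume t: "\<bar>t\<bar> \<le> r"
      have "2 \<le> real n * (1 - r\<^sup>2)" using elim r by (simp add: field_simps)
      also have "\<dots> \<le> real (Suc n) * (1 - t\<^sup>2)"
        using r power_mono[OF t, of 2] by (intro mult_mono) auto
      finally show "2 \<le> real (Suc n) * (1 - t\<^sup>2)" .
    qed
  qed
qed (auto intro: always_eventually)

text \<open>One index drives both the regularization and the cutoff. The successor keeps the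
  regularization positive also for \<open>n = 0\<close>, where \<open>inverse 0\<close> would be
  0.\<close>

definition cal_field :: "real \<Rightarrow> nat \<Rightarrow> real^2 \<Rightarrow> real^2" where
  "cal_field a n x =
    (let q = cal_slope a (inverse (real (Suc n))) x; \<eta> = cutoff (real (Suc n)) (x $ 1) * cutoff (real (Suc n)) (x $ 2)
     in vector [\<eta> * (- q / sqrt (1 + q\<^sup>2)), \<eta> * (1 / sqrt (1 + q\<^sup>2))])"

section \<open>Differentiability of the truncated field\<close>

lemma has_derivative_nth: "((\<lambda>x. x $ i) has_derivative (\<lambda>h. h $ i)) (at (x :: real^2))"
  by (rule bounded_linear_imp_has_derivative) (rule bounded_linear_vec_nth)

text \<open>Since \<open>e > 0\<close> keeps the weight positive, its fractional power is
  differentiable everywhere, the origin included.\<close>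

lemma cal_slope_has_derivative:
  assumes a: "0 < a" and e: "0 < e"
  shows "(cal_slope a e has_derivative (\<lambda>h. cal_slope1 a e x * h $ 1 + cal_slope2 a e x * h $ 2)) (at x)"
proof -
  have "((\<lambda>t. \<bar>t\<bar> powr (2 + 2 * a)) has_real_derivative (2 + 2 * a) * spow (1 + 2 * a) (x $ 1)) (at (x $ 1))"
    using DERIV_abs_powr[of "2 + 2 * a" "x $ 1"] a by (simp add: spow_def mult.assoc)
  from DERIV_compose_FDERIV[OF this has_derivative_nth]
  have d1: "((\<lambda>x. \<bar>x $ 1\<bar> powr (2 + 2 * a)) has_derivative (\<lambda>h. h $ 1 * ((2 + 2 * a) * spow (1 + 2 * a) (x $ 1)))) (at x)" .
  have "((\<lambda>t. t\<^sup>2) has_real_derivative 2 * x $ 2) (at (x $ 2))"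
    by (auto intro!: derivative_eq_intros)
  from DERIV_compose_FDERIV[OF this has_derivative_nth]
  have d2: "((\<lambda>x. (x $ 2)\<^sup>2) has_derivative (\<lambda>h. h $ 2 * (2 * x $ 2))) (at x)" .
  have "((\<lambda>x. (\<bar>x $ 1\<bar> powr (2 + 2 * a) + (x $ 2)\<^sup>2 + e) * (1 / 2)) has_derivative
      (\<lambda>h. (h $ 1 * ((2 + 2 * a) * spow (1 + 2 * a) (x $ 1)) + h $ 2 * (2 * x $ 2) + 0) * (1 / 2))) (at x)"
    by (intro has_derivative_mult_left has_derivative_add has_derivative_const d1 d2)
  then have "(cal_weight a e has_derivative
      (\<lambda>h. (h $ 1 * ((2 + 2 * a) * spow (1 + 2 * a) (x $ 1)) + 2 * x $ 2 * h $ 2) / 2)) (at x)"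
    by (simp add: cal_weight_def[abs_def] mult_ac)
  from DERIV_compose_FDERIV[OF has_real_derivative_powr[OF cal_weight_pos[OF e]] this, of "a / (2 + 2 * a)"]
  have "((\<lambda>x. (1 + a) * cal_weight a e x powr (a / (2 + 2 * a))) has_derivative
      (\<lambda>h. (1 + a) * ((h $ 1 * ((2 + 2 * a) * spow (1 + 2 * a) (x $ 1)) + 2 * x $ 2 * h $ 2) / 2
        * (a / (2 + 2 * a) * cal_weight a e x powr (a / (2 + 2 * a) - 1))))) (at x)"
    by (rule has_derivative_mult_right)
  moreover have "(1 + a) * ((h $ 1 * ((2 + 2 * a) * spow (1 + 2 * a) (x $ 1)) + 2 * x $ 2 * h $ 2) / 2
        * (a / (2 + 2 * a) * cal_weight a e x powr (a / (2 + 2 * a) - 1)))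
      = cal_slope1 a e x * h $ 1 + cal_slope2 a e x * h $ 2" for h :: "real^2"
  proof -
    have *: "(1 + a) * (a / (2 + 2 * a)) = a / 2" using a by (simp add: field_simps)
    have factor: "(1 + a) * (((h $ 1 * ((2 + 2 * a) * S) + 2 * x $ 2 * h $ 2) / 2) * (c * w))
      = ((1 + a) * c) * w * ((1 + a) * S * h $ 1 + x $ 2 * h $ 2)" for S w c
      by (simp add: field_simps)
    show ?thesis unfolding factor * by (simp add: cal_slope1_def cal_slope2_def algebra_simps)
  qed
  ultimately show ?thesis by (simp add: cal_slope_def[abs_def])
qed

lemma continuous_on_cal_weight: "0 < a \<Longrightarrow> continuous_on S (cal_weight a e)"
  unfolding cal_weight_def[abs_def]
  by (intro continuous_intros continuous_on_compose2[OF continuous_on_abs_powr[of _ UNIV]]) auto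

lemma continuous_on_cal_slopes:
  assumes "0 < a" "0 < e"
  shows "continuous_on S (cal_slope a e)" "continuous_on S (cal_slope1 a e)" "continuous_on S (cal_slope2 a e)"
  unfolding cal_slope_def[abs_def] cal_slope1_def[abs_def] cal_slope2_def[abs_def]
  using assms cal_weight_pos[OF assms(2), of a]
  by (auto intro!: continuous_intros continuous_on_cal_weight continuous_on_compose2[OF continuous_on_spow[of _ UNIV]]
      simp: less_imp_neq[symmetric])

text \<open>By the chain rule these two derivatives produce the divergence formula recorded in
  \<open>cal_curv\<close>.\<close>

lemma DERIV_unit_normal:
  fixes q :: real
  shows "((\<lambda>q. - q / sqrt (1 + q\<^sup>2)) has_real_derivative - 1 / sqrt (1 + q\<^sup>2) ^ 3) (at q)"
    and "((\<lambda>q. 1 / sqrt (1 + q\<^sup>2)) has_real_derivative - q / sqrt (1 + q\<^sup>2) ^ 3) (at q)"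
proof -
  define r where "r = sqrt (1 + q\<^sup>2)"
  have pos: "0 < 1 + q\<^sup>2" by (simp add: add_pos_nonneg)
  then have r: "r > 0" "1 + q\<^sup>2 = r\<^sup>2" by (auto simp: r_def)
  have D: "((\<lambda>q. sqrt (1 + q\<^sup>2)) has_real_derivative q / r) (at q)"
    using pos by (auto intro!: derivative_eq_intros simp: r_def field_simps)
  have "((\<lambda>q. - q / sqrt (1 + q\<^sup>2)) has_real_derivative ((- 1) * r - (- q) * (q / r)) / (r * r)) (at q)"
    unfolding r_def by (rule DERIV_divide[OF _ D[unfolded r_def]]) (use pos in \<open>auto intro!: derivative_eq_intros\<close>)
  moreover have "((- 1) * r - (- q) * (q / r)) / (r * r) = - (r\<^sup>2 - q\<^sup>2) / r ^ 3"
    using r(1) by (simp add: field_simps power2_eq_square power3_eq_cube)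
  ultimately show "((\<lambda>q. - q / sqrt (1 + q\<^sup>2)) has_real_derivative - 1 / sqrt (1 + q\<^sup>2) ^ 3) (at q)"
    using r(2)[symmetric] by (simp add: r_def[symmetric])
  have D2: "((\<lambda>q. 1 / sqrt (1 + q\<^sup>2)) has_real_derivative (0 * r - 1 * (q / r)) / (r * r)) (at q)"
    unfolding r_def by (rule DERIV_divide[OF _ D[unfolded r_def]]) (use pos in auto)
  have "(0 * r - 1 * (q / r)) / (r * r) = - q / r ^ 3"
    using r(1) by (simp add: field_simps power2_eq_square power3_eq_cube)
  from DERIV_cong[OF D2 this]
  show "((\<lambda>q. 1 / sqrt (1 + q\<^sup>2)) has_real_derivative - q / sqrt (1 + q\<^sup>2) ^ 3) (at q)"
    unfolding r_def .
qed

text \<open>The field is a unit vector times a cutoff with values between 0 and 1, hence of length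
  at most 1. Where both cutoffs equal 1 their derivatives vanish and only the divergence of the unit
  field remains.\<close>

lemma cal_field:
  fixes a :: real and n :: nat
  assumes a: "0 < a"
  shows "test_field square (cal_field a n)"
    and "2 \<le> real (Suc n) * (1 - (x $ 1)\<^sup>2) \<Longrightarrow> 2 \<le> real (Suc n) * (1 - (x $ 2)\<^sup>2) \<Longrightarrow>
      divergence (cal_field a n) x = cal_curv a (inverse (real (Suc n))) x"
proof -
  define e where "e = inverse (real (Suc n))"
  have e: "0 < e" by (simp add: e_def)
  define m where "m = real (Suc n)"
  define q where "q = cal_slope a e"
  define \<eta> where "\<eta> = (\<lambda>x::real^2. cutoff m (x $ 1) * cutoff m (x $ 2))"
  define \<eta>1 where "\<eta>1 = (\<lambda>x::real^2. cutoff' m (x $ 1) * cutoff m (x $ 2))"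
  define \<eta>2 where "\<eta>2 = (\<lambda>x::real^2. cutoff m (x $ 1) * cutoff' m (x $ 2))"
  define R where "R = (\<lambda>x. sqrt (1 + (q x)\<^sup>2))"
  have field: "cal_field a n = (\<lambda>x. vector [\<eta> x * (- q x / R x), \<eta> x * (1 / R x)])"
    by (simp add: cal_field_def[abs_def] Let_def q_def \<eta>_def R_def m_def e_def)
  have Rpos: "R x > 0" for x by (simp add: R_def add_pos_nonneg)
  have Rne: "R x \<noteq> 0" for x using Rpos[of x] by simp
  have dc: "((\<lambda>x. cutoff m (x $ i)) has_derivative (\<lambda>h. h $ i * cutoff' m (x $ i))) (at x)" for i and x :: "real^2"
    by (rule DERIV_compose_FDERIV[OF DERIV_cutoff has_derivative_nth])
  have d\<eta>: "(\<eta> has_derivative (\<lambda>h. \<eta>1 x * h $ 1 + \<eta>2 x * h $ 2)) (at x)" for x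
    using has_derivative_mult[OF dc[of 1 x] dc[of 2 x]]
    by (simp add: \<eta>_def[abs_def] \<eta>1_def \<eta>2_def algebra_simps)
  note dq = cal_slope_has_derivative[OF a e, folded q_def]
  have dA: "((\<lambda>x. - q x / R x) has_derivative (\<lambda>h. (cal_slope1 a e x * h $ 1 + cal_slope2 a e x * h $ 2) * (- 1 / R x ^ 3))) (at x)" for x
    using DERIV_compose_FDERIV[OF DERIV_unit_normal(1) dq] by (simp add: R_def)
  have dB: "((\<lambda>x. 1 / R x) has_derivative (\<lambda>h. (cal_slope1 a e x * h $ 1 + cal_slope2 a e x * h $ 2) * (- q x / R x ^ 3))) (at x)" for x
    using DERIV_compose_FDERIV[OF DERIV_unit_normal(2) dq] by (simp add: R_def)
  define f1 where "f1 = (\<lambda>x. \<eta>1 x * (- q x / R x) + \<eta> x * (cal_slope1 a e x * (- 1 / R x ^ 3)))"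
  define f2 where "f2 = (\<lambda>x. \<eta>2 x * (- q x / R x) + \<eta> x * (cal_slope2 a e x * (- 1 / R x ^ 3)))"
  define g1 where "g1 = (\<lambda>x. \<eta>1 x * (1 / R x) + \<eta> x * (cal_slope1 a e x * (- q x / R x ^ 3)))"
  define g2 where "g2 = (\<lambda>x. \<eta>2 x * (1 / R x) + \<eta> x * (cal_slope2 a e x * (- q x / R x ^ 3)))"
  have f: "((\<lambda>x. \<eta> x * (- q x / R x)) has_derivative (\<lambda>h. f1 x * h $ 1 + f2 x * h $ 2)) (at x)" for x
    by (rule has_derivative_eq_rhs[OF has_derivative_mult[OF d\<eta> dA]]) (simp add: fun_eq_iff f1_def f2_def algebra_simps)
  have g: "((\<lambda>x. \<eta> x * (1 / R x)) has_derivative (\<lambda>h. g1 x * h $ 1 + g2 x * h $ 2)) (at x)" for x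
    by (rule has_derivative_eq_rhs[OF has_derivative_mult[OF d\<eta> dB]]) (simp add: fun_eq_iff g1_def g2_def algebra_simps)
  have cc: "continuous_on UNIV (\<lambda>x::real^2. cutoff m (x $ i))" "continuous_on UNIV (\<lambda>x::real^2. cutoff' m (x $ i))" for i
    by (auto intro!: continuous_intros continuous_on_compose2[OF continuous_on_cutoff[of UNIV]]
        continuous_on_compose2[OF continuous_on_cutoff'[of UNIV]])
  have c\<eta>: "continuous_on UNIV \<eta>" "continuous_on UNIV \<eta>1" "continuous_on UNIV \<eta>2"
    unfolding \<eta>_def \<eta>1_def \<eta>2_def by (intro continuous_intros cc)+
  have cq: "continuous_on UNIV q" "continuous_on UNIV (cal_slope1 a e)" "continuous_on UNIV (cal_slope2 a e)"
    using continuous_on_cal_slopes[OF a e] by (auto simp: q_def)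
  have cR: "continuous_on UNIV R" unfolding R_def by (intro continuous_intros cq)
  have cont: "continuous_on UNIV f1" "continuous_on UNIV f2" "continuous_on UNIV g1" "continuous_on UNIV g2"
    unfolding f1_def f2_def g1_def g2_def using Rne
    by (intro continuous_intros c\<eta> cq cR; simp)+
  \<comment> \<open>For \<open>\<bar>t\<bar> \<ge> \<rho>\<close> the quantity
    \<open>m * (1 - t\<^sup>2)\<close> is at most 1, so the cutoff vanishes; the closed square of
    half-side \<open>\<rho>\<close> contains the support.\<close>
  define \<rho> where "\<rho> = sqrt (1 - 1 / m)"
  have m: "1 \<le> m" by (simp add: m_def)
  have \<rho>: "0 \<le> \<rho>" "\<rho> < 1" "\<rho>\<^sup>2 = 1 - 1 / m" using m by (auto simp: \<rho>_def)
  define K :: "(real^2) set" where "K = cbox (\<chi> i. - \<rho>) (\<chi> i. \<rho>)"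
  have K_iff: "x \<in> K \<longleftrightarrow> \<bar>x $ 1\<bar> \<le> \<rho> \<and> \<bar>x $ 2\<bar> \<le> \<rho>" for x
    by (auto simp: K_def mem_box_cart forall_2 abs_le_iff)
  have cut0: "cutoff m t = 0" if "\<not> \<bar>t\<bar> \<le> \<rho>" for t
  proof -
    have "\<rho>\<^sup>2 \<le> \<bar>t\<bar>\<^sup>2" using that \<rho> by (intro power_mono) auto
    then have "m * (1 - t\<^sup>2) \<le> m * (1 / m)" using \<rho>(3) m by (intro mult_left_mono) auto
    then show ?thesis using m by (simp add: cutoff_def bump_eq_0)
  qed
  have K: "compact K" "K \<subseteq> square"
    using \<rho>(2) by (auto simp: K_def[THEN arg_cong[of _ _ compact]] K_iff square_def forall_2)
  have off: "\<eta> x * (- q x / R x) = 0 \<and> \<eta> x * (1 / R x) = 0" if "x \<notin> K" for x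
  proof -
    have "\<eta> x = 0" using that cut0 unfolding K_iff by (auto simp: \<eta>_def)
    then show ?thesis by simp
  qed
  have le: "(\<eta> x * (- q x / R x))\<^sup>2 + (\<eta> x * (1 / R x))\<^sup>2 \<le> 1" for x
  proof -
    have "0 \<le> \<eta> x" "\<eta> x \<le> 1" unfolding \<eta>_def cutoff_def using bump_bounds by (auto intro: mult_le_one)
    then have \<eta>: "(\<eta> x)\<^sup>2 \<le> 1" by (simp add: power_le_one)
    have R2: "(R x)\<^sup>2 = 1 + (q x)\<^sup>2" by (simp add: R_def)
    have "(\<eta> x * (- q x / R x))\<^sup>2 + (\<eta> x * (1 / R x))\<^sup>2 = (\<eta> x)\<^sup>2 * ((1 + (q x)\<^sup>2) / (R x)\<^sup>2)"
      by (simp add: power_mult_distrib power_divide add_divide_distrib distrib_left)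
    also have "\<dots> = (\<eta> x)\<^sup>2" using Rne[of x] by (simp flip: R2)
    finally show ?thesis using \<eta> by simp
  qed
  show "test_field square (cal_field a n)"
    unfolding field by (rule test_fieldI(1)[OF f g cont K off le])
  assume "2 \<le> real (Suc n) * (1 - (x $ 1)\<^sup>2)" "2 \<le> real (Suc n) * (1 - (x $ 2)\<^sup>2)"
  then have "\<eta> x = 1" "\<eta>1 x = 0" "\<eta>2 x = 0"
    by (simp_all add: \<eta>_def \<eta>1_def \<eta>2_def m_def cutoff_eq_1)
  moreover have "divergence (cal_field a n) x = f1 x + g2 x"
    unfolding field by (rule test_fieldI(2)[OF f g cont K off le])
  moreover have "cal_curv a e x = - (cal_slope1 a e x + q x * cal_slope2 a e x) / R x ^ 3"
    by (simp add: cal_curv_def q_def R_def)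
  ultimately show "divergence (cal_field a n) x = cal_curv a (inverse (real (Suc n))) x"
    unfolding e_def[symmetric] by (simp add: f1_def g2_def add_divide_distrib diff_divide_distrib mult.commute)
qed

subsection \<open>Passing to the limit\<close>

lemma cal_weight_tendsto:
  "(\<lambda>n. cal_weight a (inverse (real (Suc n))) x) \<longlonglongrightarrow> cal_weight a 0 x"
  unfolding cal_weight_def by (intro tendsto_intros LIMSEQ_inverse_real_of_nat) auto

text \<open>The limit weight may vanish at the origin, but the exponent is positive and the
  approximating weights are nonnegative, so the power still converges.\<close>

lemma cal_slope_tendsto:
  assumes "0 < a"
  shows "(\<lambda>n. cal_slope a (inverse (real (Suc n))) x) \<longlonglongrightarrow> cal_slope a 0 x"
  unfolding cal_slope_def
proof (intro tendsto_mult_left tendsto_powr' cal_weight_tendsto tendsto_const disjI2 conjI)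
  show "\<forall>\<^sub>F n in sequentially. 0 \<le> cal_weight a (inverse (real (Suc n))) x"
    using cal_weight_pos[of "inverse (real (Suc _))" a x] by (intro always_eventually allI less_imp_le) simp
qed (use assms in auto)

text \<open>The derivatives of the slope carry a negative power of the weight, so the limit weight
  must be nonzero; \<open>x $ 1 \<noteq> 0\<close> ensures this.\<close>

lemma cal_curv_tendsto:
  assumes "0 < a" "x $ 1 \<noteq> 0"
  shows "(\<lambda>n. cal_curv a (inverse (real (Suc n))) x) \<longlonglongrightarrow> cal_curv a 0 x"
proof -
  have ne: "cal_weight a 0 x \<noteq> 0" using cal_weight_0_pos[OF assms(2), of a] by simp
  have "sqrt (1 + (cal_slope a 0 x)\<^sup>2) ^ 3 \<noteq> 0"
    using add_pos_nonneg[of 1 "(cal_slope a 0 x)\<^sup>2"] by auto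
  then show ?thesis
    unfolding cal_curv_def cal_slope1_def cal_slope2_def
    using ne by (intro tendsto_intros cal_slope_tendsto cal_weight_tendsto assms) auto
qed

text \<open>On the graph both terms of the weight equal
  \<open>\<bar>t\<bar> powr (2 + 2 * a)\<close>, and so does their mean; this makes the field normal
  to the graph.\<close>

lemma cal_slope_graph:
  assumes "0 < a"
  shows "cal_slope a 0 (vector [t, spow (1 + a) t]) = (1 + a) * \<bar>t\<bar> powr a"
proof -
  have "(spow (1 + a) t)\<^sup>2 = \<bar>spow (1 + a) t\<bar>\<^sup>2" by simp
  also have "\<dots> = \<bar>t\<bar> powr (2 + 2 * a)"
    by (simp only: abs_spow power2_eq_square flip: powr_add) (simp add: algebra_simps)
  finally show ?thesis using assms
    by (simp add: cal_slope_def cal_weight_def powr_powr)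
qed

text \<open>Cauchy-Schwarz against \<open>(-p, 1)\<close>, the unnormalized normal of a graph of
  slope \<open>p\<close>.\<close>

lemma normal_component_le:
  fixes v :: "real^2"
  assumes "norm v \<le> 1"
  shows "\<bar>v $ 2 - p * v $ 1\<bar> \<le> sqrt (1 + p\<^sup>2)"
proof -
  let ?w = "vector [- p, 1] :: real^2"
  have "v $ 2 - p * v $ 1 = ?w \<bullet> v" by (simp add: inner_vec_def sum_2)
  then have "\<bar>v $ 2 - p * v $ 1\<bar> \<le> norm ?w * norm v" by (metis Cauchy_Schwarz_ineq2)
  also have "\<dots> \<le> norm ?w * 1" using assms by (intro mult_left_mono) auto
  also have "norm ?w = sqrt (1 + p\<^sup>2)" by (simp add: norm_vec_def L2_set_def sum_2 add.commute)
  finally show ?thesis by simp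
qed

section \<open>Perimeter and flux through the graph\<close>

definition graph_length :: "real \<Rightarrow> real" where
  "graph_length a = (LBINT t:{-1..1}. sqrt (1 + ((1 + a) * \<bar>t\<bar> powr a)\<^sup>2))"

lemma graph_length_integrable:
  assumes "0 < a"
  shows "set_integrable lborel {-1..1} (\<lambda>t. sqrt (1 + ((1 + a) * \<bar>t\<bar> powr a)\<^sup>2))"
  using assms by (intro borel_integrable_atLeastAtMost' continuous_intros continuous_on_abs_powr)

lemma graph_flux_continuous:
  assumes "0 < a" "test_field square \<phi>"
  shows "continuous_on S (\<lambda>t. \<phi> (vector [t, spow (1 + a) t]) $ 2
        - (1 + a) * \<bar>t\<bar> powr a * \<phi> (vector [t, spow (1 + a) t]) $ 1)"
proof -
  have "continuous_on UNIV \<phi>"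
    using assms(2) has_derivative_continuous
    unfolding test_field_def continuous_on_eq_continuous_at[OF open_UNIV] by blast
  then have "continuous_on S (\<lambda>t. \<phi> (vector [t, spow (1 + a) t]))"
    by (rule continuous_on_compose2) (use assms(1) in \<open>auto intro!: continuous_intros continuous_on_spow\<close>)
  then show ?thesis using assms(1) by (intro continuous_intros continuous_on_abs_powr)
qed

lemma perimeter_Eset_le:
  assumes a: "0 < a"
  shows "perimeter (Eset a) square \<le> ereal (graph_length a)"
  unfolding perimeter_def
proof (rule SUP_least)
  fix \<phi> assume "\<phi> \<in> {\<phi>. test_field square \<phi>}"
  then have \<phi>: "test_field square \<phi>" by simp
  then have le: "norm (\<phi> x) \<le> 1" for x by (simp add: test_field_def)
  have "(LINT x:Eset a|lebesgue. divergence \<phi> x) \<le> graph_length a"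
    unfolding integral_divergence_Eset[OF a \<phi>] graph_length_def
    using normal_component_le[OF le] abs_le_D1
    by (intro set_integral_mono graph_length_integrable[OF a]
        borel_integrable_atLeastAtMost' graph_flux_continuous[OF a \<phi>]) blast
  then show "ereal (LINT x:Eset a|lebesgue. divergence \<phi> x) \<le> ereal (graph_length a)" by simp
qed

text \<open>The arc length integrand dominates every flux density and is its pointwise limit inside
  the interval, because the limiting field is the unit normal on the graph. The endpoints are
  null.\<close>

lemma integral_divergence_cal_field_tendsto:
  assumes a: "0 < a"
  shows "(\<lambda>n. LINT x:Eset a|lebesgue. divergence (cal_field a n) x) \<longlonglongrightarrow> graph_length a"
  unfolding integral_divergence_Eset[OF a cal_field(1)[OF a]] graph_length_def
  unfolding set_lebesgue_integral_def
proof (rule integral_dominated_convergence)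
  let ?p = "\<lambda>t. (1 + a) * \<bar>t\<bar> powr a"
  let ?x = "\<lambda>t. vector [t, spow (1 + a) t] :: real^2"
  let ?F = "\<lambda>n t. cal_field a n (?x t) $ 2 - ?p t * cal_field a n (?x t) $ 1"
  have norm_le: "norm (cal_field a n x) \<le> 1" for n x
    using cal_field(1)[OF a, of n] by (simp add: test_field_def)
  show int: "integrable lborel (\<lambda>t. indicator {-1..1} t *\<^sub>R sqrt (1 + (?p t)\<^sup>2))"
    using graph_length_integrable[OF a] by (simp add: set_integrable_def)
  then show "(\<lambda>t. indicator {-1..1} t *\<^sub>R sqrt (1 + (?p t)\<^sup>2)) \<in> borel_measurable lborel"
    by (rule borel_measurable_integrable)
  show "(\<lambda>t. indicator {-1..1} t *\<^sub>R ?F n t) \<in> borel_measurable lborel" for n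
    using borel_integrable_atLeastAtMost'[OF graph_flux_continuous[OF a cal_field(1)[OF a]], of "-1" 1 n]
    unfolding set_integrable_def by (rule borel_measurable_integrable)
  show "AE t in lborel. norm (indicator {-1..1} t *\<^sub>R ?F n t) \<le> indicator {-1..1} t *\<^sub>R sqrt (1 + (?p t)\<^sup>2)" for n
    using normal_component_le[OF norm_le] by (intro AE_I2) (auto simp: indicator_def)
  have conv: "(\<lambda>n. ?F n t) \<longlonglongrightarrow> sqrt (1 + (?p t)\<^sup>2)" if t: "\<bar>t\<bar> < 1" for t
  proof -
    have "\<bar>spow (1 + a) t\<bar> \<le> \<bar>t\<bar>" using abs_spow_le[of "1 + a" t] a t by simp
    \<comment> \<open>As the height of the graph is at most \<open>\<bar>t\<bar>\<close> in modulus,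
      the same indices serve both coordinates.\<close>
    then have cut: "\<forall>\<^sub>F n in sequentially. cutoff (real (Suc n)) t = 1 \<and> cutoff (real (Suc n)) (spow (1 + a) t) = 1"
      using eventually_two_le_one_minus_sq[OF t] by (auto elim!: eventually_mono simp: cutoff_eq_1)
    define r where "r = sqrt (1 + (?p t)\<^sup>2)"
    have r: "0 < r" "r\<^sup>2 = 1 + (?p t)\<^sup>2" using add_pos_nonneg[of 1 "(?p t)\<^sup>2"] by (auto simp: r_def)
    define q where "q = (\<lambda>n. cal_slope a (inverse (real (Suc n))) (?x t))"
    have q: "q \<longlonglongrightarrow> ?p t" using cal_slope_tendsto[OF a, of "?x t"] by (simp add: q_def cal_slope_graph[OF a])
    have "(\<lambda>n. 1 / sqrt (1 + (q n)\<^sup>2) - ?p t * (- q n / sqrt (1 + (q n)\<^sup>2)))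
        \<longlonglongrightarrow> 1 / r - ?p t * (- ?p t / r)"
      unfolding r_def using r(1) by (intro tendsto_intros q) (auto simp: r_def)
    also have "1 / r - ?p t * (- ?p t / r) = (1 + (?p t)\<^sup>2) / r"
      by (simp add: add_divide_distrib power2_eq_square)
    also have "\<dots> = r" unfolding r(2)[symmetric] using r(1) by (simp add: power2_eq_square)
    finally have "(\<lambda>n. 1 / sqrt (1 + (q n)\<^sup>2) - ?p t * (- q n / sqrt (1 + (q n)\<^sup>2))) \<longlonglongrightarrow> r" .
    then show ?thesis unfolding r_def
    proof (rule Lim_transform_eventually)
      show "\<forall>\<^sub>F n in sequentially. 1 / sqrt (1 + (q n)\<^sup>2) - ?p t * (- q n / sqrt (1 + (q n)\<^sup>2)) = ?F n t"
        using cut by eventually_elim (simp add: cal_field_def Let_def q_def)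
    qed
  qed
  have "AE t in lborel. t \<noteq> 1 \<and> t \<noteq> (- 1 :: real)"
    using AE_lborel_singleton[of "1::real"] AE_lborel_singleton[of "- 1::real"] by eventually_elim auto
  then show "AE t in lborel. (\<lambda>n. indicator {-1..1} t *\<^sub>R ?F n t) \<longlonglongrightarrow> indicator {-1..1} t *\<^sub>R sqrt (1 + (?p t)\<^sup>2)"
  proof eventually_elim
    case (elim t)
    show ?case
    proof (cases "\<bar>t\<bar> < 1")
      case True
      then show ?thesis by (intro tendsto_scaleR tendsto_const conv)
    next
      case False
      then have "t \<notin> {-1..1}" using elim by auto
      then show ?thesis by simp
    qed
  qed
qed

section \<open>Integrability of the curvature and minimality of the set\<close>

lemma in_Lp_cal_curv:
  assumes a: "0 < a" "a < 1" and p: "0 \<le> p" "p * (1 - a) < 2 + a"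
  shows "in_Lp p square (cal_curv a 0)"
proof -
  have sq: "square \<in> sets lebesgue" using open_square by (simp add: borel_open)
  have m: "cal_curv a 0 \<in> borel_measurable lebesgue"
    by (rule measurable_completion) (simp add: borel_measurable_cal_curv)
  have m2: "set_borel_measurable lebesgue square (cal_curv a 0)"
    unfolding set_borel_measurable_def using m sq by measurable
  have "set_integrable lebesgue square (\<lambda>x. \<bar>cal_curv a 0 x\<bar> powr p)"
    unfolding set_integrable_def
  proof (rule Bochner_Integration.integrable_bound)
    show "integrable lebesgue (\<lambda>x. indicator square x *\<^sub>R cal_bound a x powr p)"
      using integrable_cal_bound[OF a p] by (simp add: set_integrable_def)
    show "(\<lambda>x. indicator square x *\<^sub>R \<bar>cal_curv a 0 x\<bar> powr p) \<in> borel_measurable lebesgue"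
      using m sq by measurable
    show "AE x in lebesgue. norm (indicator square x *\<^sub>R \<bar>cal_curv a 0 x\<bar> powr p)
        \<le> norm (indicator square x *\<^sub>R cal_bound a x powr p)"
      using AE_coords_nonzero
    proof eventually_elim
      case (elim x)
      then have "\<bar>cal_curv a 0 x\<bar> powr p \<le> cal_bound a x powr p"
        using abs_cal_curv_le_bound[OF a, of 0 x] p by (intro powr_mono2) auto
      then show ?case by (simp add: indicator_def)
    qed
  qed
  with m2 show ?thesis by (simp add: in_Lp_def)
qed

text \<open>The calibration criterion is applied with the fields \<open>cal_field a n\<close>, the
  flux limit \<open>graph_length a\<close> and the majorant \<open>cal_bound a\<close>.\<close>

lemma var_mean_curvature_Eset:
  assumes a: "0 < a" "a < 1"
  shows "var_mean_curvature (Eset a) square (cal_curv a 0)"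
proof (rule var_mean_curvature_calibration)
  show "Eset a \<in> sets lebesgue" by simp
  show "Eset a \<subseteq> square" by (auto simp: Eset_def)
  have bound_nonneg: "0 \<le> cal_bound a x" for x by (simp add: cal_bound_def)
  have g1: "set_integrable lebesgue square (\<lambda>x. cal_bound a x powr 1)"
    using a by (intro integrable_cal_bound) auto
  then show "set_integrable lebesgue square (cal_bound a)" by (simp add: bound_nonneg)
  have "set_integrable lebesgue square (\<lambda>x. \<bar>cal_curv a 0 x\<bar> powr 1)" and m: "set_borel_measurable lebesgue square (cal_curv a 0)"
    using in_Lp_cal_curv[OF a, of 1] a by (auto simp: in_Lp_def)
  then show "set_integrable lebesgue square (cal_curv a 0)"
    using set_integrable_abs_iff[OF m] by simp
  fix K :: "(real^2) set" assume K: "compact K" "K \<subseteq> square"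
  \<comment> \<open>The maximum norm attains its supremum on a nonempty compact \<open>K\<close>.
    With this margin the cutoffs are eventually 1 on all of \<open>K\<close>, where the divergence
    is then exactly the regularized curvature.\<close>
  have "\<exists>r<1. \<forall>x\<in>K. \<bar>x $ 1\<bar> \<le> r \<and> \<bar>x $ 2\<bar> \<le> r"
  proof (cases "K = {}")
    case True
    then show ?thesis by (auto intro: exI[of _ 0])
  next
    case False
    have "continuous_on K (\<lambda>x. max \<bar>x $ 1\<bar> \<bar>x $ 2\<bar>)" by (intro continuous_intros)
    from continuous_attains_sup[OF K(1) False this]
    obtain y where y: "y \<in> K" "\<And>x. x \<in> K \<Longrightarrow> max \<bar>x $ 1\<bar> \<bar>x $ 2\<bar> \<le> max \<bar>y $ 1\<bar> \<bar>y $ 2\<bar>" by blast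
    moreover have "max \<bar>y $ 1\<bar> \<bar>y $ 2\<bar> < 1" using y(1) K(2) by (auto simp: square_def)
    ultimately show ?thesis by (intro exI[of _ "max \<bar>y $ 1\<bar> \<bar>y $ 2\<bar>"]) auto
  qed
  then obtain r where r: "r < 1" "\<And>x. x \<in> K \<Longrightarrow> \<bar>x $ 1\<bar> \<le> r \<and> \<bar>x $ 2\<bar> \<le> r" by blast
  have div: "\<forall>\<^sub>F n in sequentially. \<forall>x\<in>K. divergence (cal_field a n) x = cal_curv a (inverse (real (Suc n))) x"
    using eventually_two_le_one_minus_sq[OF r(1)]
    by eventually_elim (use r(2) in \<open>blast intro: cal_field(2)[OF a(1)]\<close>)
  show "\<forall>\<^sub>F n in sequentially. AE x in lebesgue. x \<in> K \<longrightarrow> \<bar>divergence (cal_field a n) x\<bar> \<le> cal_bound a x"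
    using div
  proof eventually_elim
    case (elim n)
    show ?case
      using AE_coords_nonzero by eventually_elim (use elim abs_cal_curv_le_bound[OF a] in auto)
  qed
  show "AE x in lebesgue. x \<in> K \<longrightarrow> (\<lambda>n. divergence (cal_field a n) x) \<longlonglongrightarrow> cal_curv a 0 x"
    using AE_coords_nonzero
  proof eventually_elim
    case (elim x)
    show ?case
    proof
      assume "x \<in> K"
      then have "\<forall>\<^sub>F n in sequentially. cal_curv a (inverse (real (Suc n))) x = divergence (cal_field a n) x"
        using div by (auto elim: eventually_mono)
      then show "(\<lambda>n. divergence (cal_field a n) x) \<longlonglongrightarrow> cal_curv a 0 x"
        using elim by (intro Lim_transform_eventually[OF cal_curv_tendsto[OF a(1)]]) auto
    qed
  qed
qed (use a open_square perimeter_Eset_le cal_field(1) integral_divergence_cal_field_tendsto in auto)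

theorem theorem4p2:
  fixes \<alpha> :: real
  assumes "0 < \<alpha>" "\<alpha> < 1"
  shows "C1a_boundary \<alpha> (Eset \<alpha>) square
       \<and> (\<forall>\<beta>. \<alpha> < \<beta> \<and> \<beta> \<le> 1 \<longrightarrow>
             (\<forall>V. open V \<and> 0 \<in> V \<longrightarrow> \<not> C1a_boundary \<beta> (Eset \<alpha>) V))
       \<and> (\<exists>H. var_mean_curvature (Eset \<alpha>) square H \<and>
              (\<forall>p::real. 1 \<le> p \<and> (p - 2) / (p + 1) < \<alpha> \<longrightarrow> in_Lp p square H))"
proof (intro conjI allI impI exI[of _ "cal_curv \<alpha> 0"])
  show "C1a_boundary \<alpha> (Eset \<alpha>) square" using assms by (rule C1a_boundary_Eset)
  show "\<not> C1a_boundary \<beta> (Eset \<alpha>) V" if "\<alpha> < \<beta> \<and> \<beta> \<le> 1" "open V \<and> 0 \<in> V" for \<beta> V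
    using assms that by (intro not_C1a_boundary_Eset) auto
  show "var_mean_curvature (Eset \<alpha>) square (cal_curv \<alpha> 0)" using assms by (rule var_mean_curvature_Eset)
  \<comment> \<open>Clearing the positive denominator \<open>p + 1\<close> turns the condition into
    \<open>p * (1 - \<alpha>) < 2 + \<alpha>\<close>.\<close>
  show "in_Lp p square (cal_curv \<alpha> 0)" if "1 \<le> p \<and> (p - 2) / (p + 1) < \<alpha>" for p
    using assms that by (intro in_Lp_cal_curv) (auto simp: field_simps)
qed

end
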